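(* Let $l\ge1$ and let $(R,G)$ be a non-reduced marked elliptic root system in a real vector space $F$ of dimension $l+2$ with a symmetric bilinear form $I$ of signature $(l,2,0)$. Then $(R,G)$ is isomorphic to one of the following marked elliptic root systems: (1) quotient $R/G$ of type $BCC_l$ ($l\ge1$): $BCC_l^{(1)}$, $BCC_l^{(1)\ast_0}$, $BCC_l^{(1)\ast_{0'}}$, $BCC_l^{(2)}(1)$ (only $l>1$), $BCC_l^{(2)}(2)$, $BCC_l^{(2)\ast_0}$, $BCC_l^{(2)\ast_1}$, $BCC_l^{(4)}$; (2) quotient of type $C^\vee BC_l$ ($l\ge1$): $C^\vee BC_l^{(1)}$, $C^\vee BC_l^{(2)}(1)$ (only $l>1$), $C^\vee BC_l^{(2)}(2)$, $C^\vee BC_l^{(2)\ast_0}$, $C^\vee BC_l^{(2)\ast_1}$, $C^\vee BC_l^{(4)}$, $C^\vee BC_l^{(4)\ast_0}$, $C^\vee BC_l^{(4)\ast_{0'}}$; (3) quotient of type $BB_l^\vee$ ($l\ge2$): $BB_l^{\vee(1)}$, $BB_l^{\vee(2)}(1)$, $BB_l^{\vee(2)}(2)$, $BB_l^{\vee(4)}$, and (only $l=2$) $BB_2^{\vee(2)\ast}$; (4) quotient of type $C^\vee C_l$ ($l\ge1$): $C^\vee C_l^{(1)}$, $C^\vee C_l^{(1)\ast_0}$, $C^\vee C_l^{(1)\ast_1}$, $C^\vee C_l^{(2)}(1)$ (only $l>1$), $C^\vee C_l^{(2)}(2)$, $C^\vee C_l^{(2)\ast_s}$, $C^\vee C_l^{(2)\ast_l}$,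 $C^\vee C_l^{(2)\ast_0}$, $C^\vee C_l^{(2)\ast_1}$, $C^\vee C_l^{(2)\ast_{1'}}$, $C^\vee C_l^{(2)\diamond}$, $C^\vee C_l^{(4)}$, $C^\vee C_l^{(4)\ast_0}$, $C^\vee C_l^{(4)\ast_1}$.
   Context: Let $F$ be a real vector space with a symmetric bilinear form $I$. For non-isotropic $\alpha\in F$ put $\alpha^\vee=\frac{2}{I(\alpha,\alpha)}\alpha$ and $w_\alpha(\lambda)=\lambda-I(\lambda,\alpha^\vee)\alpha$. A non-empty discrete subset $R\subset F$ is a generalized root system if: (1) the lattice $Q(R)=\mathbb{Z}R$ is full in $F$; (2) $I(\alpha,\alpha)\neq0$ for all $\alpha\in R$; (3) $I(\alpha^\vee,\beta)\in\mathbb{Z}$ for all $\alpha,\beta\in R$; (4) $w_\alpha(R)=R$ for all $\alpha\in R$; (5) if $R=R_1\cup R_2$ with $R_1,R_2$ mutually orthogonal, then $R_1$ or $R_2$ is empty. An elliptic root system is a generalized root system for $I$ of signature $(l,2,0)$. Then $\mathrm{rad}_{\mathbb{Z}}(I):=Q(R)\cap\mathrm{rad}(I)=\mathbb{Z}a\oplus\mathbb{Z}b$. A marking is a subspace $G\subset\mathrm{rad}(I)$ with $G\cap Q(R)$ full in $G$; one takes $G=\mathbb{R}a$. A marked elliptic root system (mERS) is a pair $(R,G)$; $R/G$ is the image of $R$ in $F/G$ (an affine root system). $R$ is reduced if for every $\alpha\in R$ neither $2\alpha$ nor $\frac12\alpha$ is in $R$. $(R,G)\cong(R',G')$ if there is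 a linear isomorphism $\varphi:F\to F'$ with $\varphi(R)=R'$, $\varphi(G)=G'$. Model realization: $F=\bigoplus_{i=1}^l\mathbb{R}\varepsilon_i\oplus\mathbb{R}a\oplus\mathbb{R}b$, $I(\varepsilon_i,\varepsilon_j)=\delta_{ij}$, $a,b$ spanning $\mathrm{rad}(I)$, $G=\mathbb{R}a$ throughout. $R(BC_l)_s=\{\pm\varepsilon_i\}$, $R(BC_l)_m=\{\pm\varepsilon_i\pm\varepsilon_j\mid i<j\}$ (empty if $l=1$), $R(BC_l)_l=\{\pm2\varepsilon_i\}$, $R(BC_l)$ their union. Affine root systems: $R(BCC_l)=R(BC_l)+\mathbb{Z}b$; $R(BB_l^\vee)=(R(BC_l)_s+\mathbb{Z}b)\cup(R(BC_l)_m+\mathbb{Z}b)\cup(R(BC_l)_l+2\mathbb{Z}b)$ ($l\ge2$); $R(C^\vee C_l)=(R(BC_l)_s+\mathbb{Z}b)\cup(R(BC_l)_m+2\mathbb{Z}b)\cup(R(BC_l)_l+2\mathbb{Z}b)$; $R(C^\vee BC_l)=(R(BC_l)_s+\mathbb{Z}b)\cup(R(BC_l)_m+2\mathbb{Z}b)\cup(R(BC_l)_l+4\mathbb{Z}b)$. For such $R(X_l)$ (and for any $R$ below), the subscripts $s,m,l$ denote the subsets whose $\varepsilon$-part lies in $R(BC_l)_s$, $R(BC_l)_m$, $R(BC_l)_l$ respectively, and $R=R_s\cup R_m\cup R_l$. Lattice subsets: $L_{i,j}=\{ma+nb\mid (m-i)(n-j)\equiv0\bmod2\}$, $L^{s_1,s_2}_{i,j}=\{s_2ma+s_1nb\mid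 (m-i)(n-j)\equiv0\bmod 2\}$ ($i,j\in\{0,1\}$, $s_1,s_2\in\mathbb{Z}_{>0}$, $m,n\in\mathbb{Z}$). Classical types, for $X_l\in\{BCC_l,C^\vee BC_l,BB_l^\vee,C^\vee C_l\}$: $R(X_l^{(1)})=R(X_l)+\mathbb{Z}a$; $R(X_l^{(2)}(i))=(R(X_l)_s+\mathbb{Z}a)\cup(R(X_l)_m+i\mathbb{Z}a)\cup(R(X_l)_l+2\mathbb{Z}a)$ for $i=1,2$; $R(X_l^{(4)})=(R(X_l)_s+\mathbb{Z}a)\cup(R(X_l)_m+2\mathbb{Z}a)\cup(R(X_l)_l+4\mathbb{Z}a)$. $\ast_i$ types ($i\in\{0,1\}$): let $t_1=1,4,2$ for $X_l=BCC_l,C^\vee BC_l,C^\vee C_l$, and $t_2$ with $(t_1,t_2)\in\{1,2,4\}^2\setminus\{(1,4),(4,1)\}$. Always $R_m=R(X_l)_m+\min\{2,t_2\}\mathbb{Z}a$. (a) If $t_1,t_2\in\{1,2\}$, $(t_1,t_2)\ne(2,2)$: $R_s=R(X_l)_s+\mathbb{Z}a$, $R_l=R(BC_l)_l+L^{t_1,t_2}_{i,i}$. (b) If $t_1=t_2=2$: $R_s=R(BC_l)_s+L_{0,0}$, $R_l=R(BC_l)_l+L^{2,2}_{i,i}$. (c) If $t_1,t_2\in\{2,4\}$, $(t_1,t_2)\neq(2,2)$: $R_s=R(BC_l)_s+L_{i,i}$, $R_l=R(X_l)_l+t_2\mathbb{Z}a$. The resulting type is named $BCC_l^{(1)\ast_i}$,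 $BCC_l^{(2)\ast_i}$, $C^\vee C_l^{(1)\ast_i}$, $C^\vee C_l^{(2)\ast_i}$, $C^\vee C_l^{(4)\ast_i}$, $C^\vee BC_l^{(2)\ast_i}$, $C^\vee BC_l^{(4)\ast_i}$ for $(t_1,t_2)=(1,1),(1,2),(2,1),(2,2),(2,4),(4,2),(4,4)$ respectively. $\ast_{i'}$ types: $R(BCC_l^{(1)\ast_{0'}})$: $R_s=R(BCC_l)_s+\mathbb{Z}a$, $R_m=R(BCC_l)_m+\mathbb{Z}a$, $R_l=R(BC_l)_l+L_{0,1}$. $R(C^\vee C_l^{(2)\ast_{1'}})$: $R_s=R(BC_l)_s+L_{0,0}$, $R_m=R(C^\vee C_l)_m+2\mathbb{Z}a$, $R_l=R(BC_l)_l+L^{2,2}_{1,0}$. $R(C^\vee BC_l^{(4)\ast_{0'}})$: $R_s=R(BC_l)_s+L_{0,1}$, $R_m=R(C^\vee BC_l)_m+2\mathbb{Z}a$, $R_l=R(C^\vee BC_l)_l+4\mathbb{Z}a$. $\ast_s,\ast_l$ types (both with $R_m=R(C^\vee C_l)_m+2\mathbb{Z}a$): $R(C^\vee C_l^{(2)\ast_s})$: $R_s=R(BC_l)_s+L_{0,0}$, $R_l=R(C^\vee C_l)_l+2\mathbb{Z}a$. $R(C^\vee C_l^{(2)\ast_l})$: $R_s=R(C^\vee C_l)_s+\mathbb{Z}a$, $R_l=R(BC_l)_l+L^{2,2}_{0,0}$. Isolated type ($l=2$): $R(BB_2^{\vee(2)\ast})=(R(BC_2)_s+\mathbb{Z}a+\mathbb{Z}b)\cup(R(BC_2)_m+L_{0,0})\cup(R(BC_2)_l+2\mathbb{Z}a+2\mathbb{Z}b)$.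 $\diamond$ type: $R(C^\vee C_l^{(2)\diamond})=(R(C^\vee C_l)_s+\mathbb{Z}a)\cup(R(C^\vee C_l)_m+\mathbb{Z}a)\cup(R(BC_l)_l+\{ma+2nb\mid m-n\equiv0\bmod2\})$. *)

theory Defs
  imports "HOL-Analysis.Analysis"
begin

text \<open>F is modelled by a type 'a of class euclidean_space (a finite-dimensional real
vector space); its built-in inner product is NOT used, the form I is separate.\<close>

definition sym_bilinear_form :: "('a::real_vector \<Rightarrow> 'a \<Rightarrow> real) \<Rightarrow> bool" where
  "sym_bilinear_form I \<longleftrightarrow> (\<forall>x y. I x y = I y x) \<and> bilinear I"

definition radical :: "('a \<Rightarrow> 'a \<Rightarrow> real) \<Rightarrow> 'a set" where
  "radical I = {x. \<forall>y. I x y = 0}"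

definition has_signature :: "('a::euclidean_space \<Rightarrow> 'a \<Rightarrow> real) \<Rightarrow> nat \<Rightarrow> nat \<Rightarrow> nat \<Rightarrow> bool" where
  "has_signature I p z n \<longleftrightarrow>
     (\<exists>B::'a list. length B = p + z + n \<and> distinct B \<and> independent (set B) \<and> span (set B) = UNIV \<and>
        (\<forall>i<length B. \<forall>j<length B. i \<noteq> j \<longrightarrow> I (B!i) (B!j) = 0) \<and>
        (\<forall>i<length B. I (B!i) (B!i) = (if i < p then 1 else if i < p + z then 0 else -1)))"

definition zspan :: "'a::real_vector set \<Rightarrow> 'a set" where
  "zspan S = {x. \<exists>T c. finite T \<and> T \<subseteq> S \<and> x = (\<Sum>v\<in>T. real_of_int (c v) *\<^sub>R v)}"

definition full_lattice_in :: "'a::real_vector set \<Rightarrow> 'a set \<Rightarrow> bool" where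
  "full_lattice_in L V \<longleftrightarrow> (\<exists>B. finite B \<and> independent B \<and> span B = V \<and> L = zspan B)"

definition coroot :: "('a::real_vector \<Rightarrow> 'a \<Rightarrow> real) \<Rightarrow> 'a \<Rightarrow> 'a" where
  "coroot I \<alpha> = (2 / I \<alpha> \<alpha>) *\<^sub>R \<alpha>"

definition wref :: "('a::real_vector \<Rightarrow> 'a \<Rightarrow> real) \<Rightarrow> 'a \<Rightarrow> 'a \<Rightarrow> 'a" where
  "wref I \<alpha> v = v - I v (coroot I \<alpha>) *\<^sub>R \<alpha>"

definition generalized_root_system :: "('a::euclidean_space \<Rightarrow> 'a \<Rightarrow> real) \<Rightarrow> 'a set \<Rightarrow> bool" where
  "generalized_root_system I R \<longleftrightarrow>
     R \<noteq> {} \<and> discrete R \<and>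
     full_lattice_in (zspan R) UNIV \<and>
     (\<forall>\<alpha>\<in>R. I \<alpha> \<alpha> \<noteq> 0) \<and>
     (\<forall>\<alpha>\<in>R. \<forall>\<beta>\<in>R. I (coroot I \<alpha>) \<beta> \<in> \<int>) \<and>
     (\<forall>\<alpha>\<in>R. wref I \<alpha> ` R = R) \<and>
     (\<forall>R1 R2. R = R1 \<union> R2 \<and> (\<forall>x\<in>R1. \<forall>y\<in>R2. I x y = 0) \<longrightarrow> R1 = {} \<or> R2 = {})"

definition elliptic_root_system :: "nat \<Rightarrow> ('a::euclidean_space \<Rightarrow> 'a \<Rightarrow> real) \<Rightarrow> 'a set \<Rightarrow> bool" where
  "elliptic_root_system l I R \<longleftrightarrow>
     sym_bilinear_form I \<and> has_signature I l 2 0 \<and> generalized_root_system I R"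

definition marking :: "('a::euclidean_space \<Rightarrow> 'a \<Rightarrow> real) \<Rightarrow> 'a set \<Rightarrow> 'a set \<Rightarrow> bool" where
  "marking I R G \<longleftrightarrow> subspace G \<and> dim G = 1 \<and> G \<subseteq> radical I \<and> full_lattice_in (G \<inter> zspan R) G"

definition marked_elliptic_root_system ::
  "nat \<Rightarrow> ('a::euclidean_space \<Rightarrow> 'a \<Rightarrow> real) \<Rightarrow> 'a set \<Rightarrow> 'a set \<Rightarrow> bool" where
  "marked_elliptic_root_system l I R G \<longleftrightarrow> elliptic_root_system l I R \<and> marking I R G"

definition reduced :: "'a::real_vector set \<Rightarrow> bool" where
  "reduced R \<longleftrightarrow> (\<forall>\<alpha>\<in>R. (2::real) *\<^sub>R \<alpha> \<notin> R \<and> (1/2::real) *\<^sub>R \<alpha> \<notin> R)"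

text \<open>Model space F = \<oplus> R\<epsilon>_i \<oplus> Ra \<oplus> Rb, realised as functions nat \<Rightarrow> real supported in
{0..<l+2}: coordinate i-1 is the \<epsilon>_i coefficient (1\<le>i\<le>l), coordinate l is the a coefficient,
coordinate l+1 is the b coefficient.\<close>
definition model_space :: "nat \<Rightarrow> (nat \<Rightarrow> real) set" where
  "model_space l = {v. \<forall>i\<ge>l+2. v i = 0}"

definition mvec :: "nat \<Rightarrow> (nat \<Rightarrow> real) \<Rightarrow> int \<Rightarrow> int \<Rightarrow> (nat \<Rightarrow> real)" where
  "mvec l e m n = (\<lambda>i. if i < l then e i else if i = l then real_of_int m
                       else if i = l + 1 then real_of_int n else 0)"

definition model_G :: "nat \<Rightarrow> (nat \<Rightarrow> real) set" where
  "model_G l = {(\<lambda>i. if i = l then c else 0) | c. True}"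

definition BCs :: "nat \<Rightarrow> (nat \<Rightarrow> real) set" where
  "BCs l = {(\<lambda>k. if k = i then s else 0) | i s. i < l \<and> (s = 1 \<or> s = -1)}"

definition BCm :: "nat \<Rightarrow> (nat \<Rightarrow> real) set" where
  "BCm l = {(\<lambda>k. if k = i then s else if k = j then t else 0) | i j s t.
              i < j \<and> j < l \<and> (s = 1 \<or> s = -1) \<and> (t = 1 \<or> t = -1)}"

definition BCl :: "nat \<Rightarrow> (nat \<Rightarrow> real) set" where
  "BCl l = {(\<lambda>k. if k = i then s else 0) | i s. i < l \<and> (s = 2 \<or> s = -2)}"

text \<open>A root set R_s \<union> R_m \<union> R_l, where the radical parts are given by sets of
pairs (m,n) standing for ma + nb.\<close>
definition mroots :: "nat \<Rightarrow> (int \<times> int) set \<Rightarrow> (int \<times> int) set \<Rightarrow> (int \<times> int) set \<Rightarrow> (nat \<Rightarrow> real) set" where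
  "mroots l Ls Lm Ll =
     {mvec l e m n | e m n. (e \<in> BCs l \<and> (m, n) \<in> Ls) \<or> (e \<in> BCm l \<and> (m, n) \<in> Lm) \<or> (e \<in> BCl l \<and> (m, n) \<in> Ll)}"

definition pL :: "int \<Rightarrow> int \<Rightarrow> (int \<times> int) set" where
  "pL p q = {(p * m, q * n) | m n. True}"

definition Lij :: "int \<Rightarrow> int \<Rightarrow> (int \<times> int) set" where
  "Lij i j = {(m, n). even ((m - i) * (n - j))}"

definition Lsij :: "int \<Rightarrow> int \<Rightarrow> int \<Rightarrow> int \<Rightarrow> (int \<times> int) set" where
  "Lsij s1 s2 i j = {(s2 * m, s1 * n) | m n. even ((m - i) * (n - j))}"

text \<open>Affine types X_l are encoded by the b-steps (bs, bm, bl) of the s,m,l parts: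
BCC = (1,1,1), BB^\<or> = (1,1,2), C^\<or>C = (1,2,2), C^\<or>BC = (1,2,4).
Classical type with a-steps (as, am, al): (1) = (1,1,1), (2)(i) = (1,i,2), (4) = (1,2,4).\<close>
definition classical :: "int \<times> int \<times> int \<Rightarrow> int \<times> int \<times> int \<Rightarrow> nat \<Rightarrow> (nat \<Rightarrow> real) set" where
  "classical bsteps asteps l = (case bsteps of (bs, bm, bl) \<Rightarrow> case asteps of (as, am, al) \<Rightarrow>
      mroots l (pL as bs) (pL am bm) (pL al bl))"

definition BCC :: "int \<times> int \<times> int" where "BCC = (1, 1, 1)"
definition BBv :: "int \<times> int \<times> int" where "BBv = (1, 1, 2)"
definition CvC :: "int \<times> int \<times> int" where "CvC = (1, 2, 2)"
definition CvBC :: "int \<times> int \<times> int" where "CvBC = (1, 2, 4)"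

definition T1 :: "int \<times> int \<times> int" where "T1 = (1, 1, 1)"
definition T2 :: "int \<Rightarrow> int \<times> int \<times> int" where "T2 i = (1, i, 2)"
definition T4 :: "int \<times> int \<times> int" where "T4 = (1, 2, 4)"

definition star_type :: "int \<Rightarrow> int \<Rightarrow> int \<Rightarrow> nat \<Rightarrow> (nat \<Rightarrow> real) set" where
  "star_type t1 t2 i l =
     (let X = (if t1 = 1 then BCC else if t1 = 4 then CvBC else CvC);
          bs = fst X; bm = fst (snd X); bl = snd (snd X);
          Lm = pL (min 2 t2) bm in
      if t1 \<in> {1,2} \<and> t2 \<in> {1,2} \<and> (t1, t2) \<noteq> (2, 2) then
        mroots l (pL 1 bs) Lm (Lsij t1 t2 i i)
      else if t1 = 2 \<and> t2 = 2 then
        mroots l (Lij 0 0) Lm (Lsij 2 2 i i)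
      else
        mroots l (Lij i i) Lm (pL t2 bl))"

definition BCC_1_star :: "int \<Rightarrow> nat \<Rightarrow> (nat \<Rightarrow> real) set" where "BCC_1_star i = star_type 1 1 i"
definition BCC_2_star :: "int \<Rightarrow> nat \<Rightarrow> (nat \<Rightarrow> real) set" where "BCC_2_star i = star_type 1 2 i"
definition CvC_1_star :: "int \<Rightarrow> nat \<Rightarrow> (nat \<Rightarrow> real) set" where "CvC_1_star i = star_type 2 1 i"
definition CvC_2_star :: "int \<Rightarrow> nat \<Rightarrow> (nat \<Rightarrow> real) set" where "CvC_2_star i = star_type 2 2 i"
definition CvC_4_star :: "int \<Rightarrow> nat \<Rightarrow> (nat \<Rightarrow> real) set" where "CvC_4_star i = star_type 2 4 i"
definition CvBC_2_star :: "int \<Rightarrow> nat \<Rightarrow> (nat \<Rightarrow> real) set" where "CvBC_2_star i = star_type 4 2 i"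
definition CvBC_4_star :: "int \<Rightarrow> nat \<Rightarrow> (nat \<Rightarrow> real) set" where "CvBC_4_star i = star_type 4 4 i"

definition BCC_1_star0' :: "nat \<Rightarrow> (nat \<Rightarrow> real) set" where
  "BCC_1_star0' l = mroots l (pL 1 1) (pL 1 1) (Lij 0 1)"
definition CvC_2_star1' :: "nat \<Rightarrow> (nat \<Rightarrow> real) set" where
  "CvC_2_star1' l = mroots l (Lij 0 0) (pL 2 2) (Lsij 2 2 1 0)"
definition CvBC_4_star0' :: "nat \<Rightarrow> (nat \<Rightarrow> real) set" where
  "CvBC_4_star0' l = mroots l (Lij 0 1) (pL 2 2) (pL 4 4)"

definition CvC_2_stars :: "nat \<Rightarrow> (nat \<Rightarrow> real) set" where
  "CvC_2_stars l = mroots l (Lij 0 0) (pL 2 2) (pL 2 2)"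
definition CvC_2_starl :: "nat \<Rightarrow> (nat \<Rightarrow> real) set" where
  "CvC_2_starl l = mroots l (pL 1 1) (pL 2 2) (Lsij 2 2 0 0)"

definition BBv2_2_star :: "(nat \<Rightarrow> real) set" where
  "BBv2_2_star = mroots 2 (pL 1 1) (Lij 0 0) (pL 2 2)"

definition CvC_2_diamond :: "nat \<Rightarrow> (nat \<Rightarrow> real) set" where
  "CvC_2_diamond l = mroots l (pL 1 1) (pL 1 2) {(m, 2 * n) | m n. even (m - n)}"

text \<open>(R,G) in F is isomorphic to (R',G') in the model space: there is a linear bijection
\<phi> : F \<rightarrow> model_space l with \<phi>(R) = R' and \<phi>(G) = G'.  (Linearity is spelled out
pointwise since nat \<Rightarrow> real carries no vector space instance.)\<close>
definition iso_to_model :: "nat \<Rightarrow> 'a::real_vector set \<Rightarrow> 'a set \<Rightarrow> (nat \<Rightarrow> real) set \<Rightarrow> bool" where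
  "iso_to_model l R G R' \<longleftrightarrow>
     (\<exists>\<phi> :: 'a \<Rightarrow> (nat \<Rightarrow> real).
        (\<forall>x y. \<phi> (x + y) = (\<lambda>i. \<phi> x i + \<phi> y i)) \<and>
        (\<forall>c x. \<phi> (c *\<^sub>R x) = (\<lambda>i. c * \<phi> x i)) \<and>
        bij_betw \<phi> UNIV (model_space l) \<and>
        \<phi> ` R = R' \<and> \<phi> ` G = model_G l)"

end

(* Normalise so that some root e0 has 2 e0 in R. A root not orthogonal to a doubled root x is, modulo
   the radical, +-x, +-2x, or a root y with I(y,y) = 2 I(x,x) whose reflection carries x to another
   doubled root orthogonal to x; by irreducibility a maximal orthogonal set of doubled roots
   e_0, ..., e_(l-1) with all e_0 - e_i in R accounts for every root, so R lies over BC_l. Weyl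
   invariance describes R by three subsets A, B, C of the rank two lattice Z a + Z b = rad(I) \<inter> Q(R),
   the fibres over short, middle and long roots. They satisfy
   A + 2(Za + Zb) = A, A + B = A, B + C = B, C + 2B = C and B + 2(Za + Zb) = B, and B is a group
   unless l = 2. Hence B is, up to the shear b -> b + a, one of the lattices with steps
   (u, v) in {1,2}^2 (or, only for l = 2, three cosets of 2(Za + Zb)), and then C is an arbitrary
   union of cosets of 2B in B containing 0. What remains are subsets of (Z/2)^2 modulo shears and
   translations of the e_i. *)

theory Submission
  imports Defs
begin

section \<open>Root systems containing a root and its double\<close>

text \<open>Doubled roots permit a direct construction: integrality against
  \<open>2 *\<^sub>R e0\<close> makes I(e0,y)/I(e0,e0) itself an integer, so the lengths of roots
  meeting e0 are limited enough to grow an orthogonal frame by hand, without the classification of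
  finite root systems. The marking allows only coordinate changes of the radical that keep the line
  Ra. This leaves shears of b along a and translations of the frame, so the middle lattices with
  steps (1,2) and (2,1) need separate treatment. Translating every frame vector by d moves short
  fibres by d but middle and long fibres by 2d (up to signs). This asymmetry shapes the list. For
  steps (1,1) only the shear is visible on long roots; for steps (2,2) shears and translations form
  a group of order eight acting at once on short and long classes modulo their periods. The steps
  (1,1), (1,2), (2,1), (2,2) contribute 6, 7, 6 and 15 types, and the exceptional middle fibre for l
  = 2 one more.\<close>

locale semidefinite_form =
  fixes I :: "'a::euclidean_space \<Rightarrow> 'a \<Rightarrow> real"
  assumes bilin: "bilinear I"
    and sym: "I x y = I y x"
    and nonneg: "I x x \<ge> 0"
    and null: "I x x = 0 \<Longrightarrow> x \<in> radical I"
begin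

lemmas form_simps =
  bilinear_ladd[OF bilin] bilinear_radd[OF bilin] bilinear_lsub[OF bilin] bilinear_rsub[OF bilin]
  bilinear_lmul[OF bilin] bilinear_rmul[OF bilin] bilinear_lneg[OF bilin] bilinear_rneg[OF bilin]
  bilinear_lzero[OF bilin] bilinear_rzero[OF bilin]

lemma radical_left: "d \<in> radical I \<Longrightarrow> I d x = 0"
  by (simp add: radical_def)

lemma radical_right: "d \<in> radical I \<Longrightarrow> I x d = 0"
  unfolding radical_def mem_Collect_eq using sym by metis

lemma subspace_radical: "subspace (radical I)"
  by (auto simp: subspace_def radical_def form_simps)

lemma form_sum_left: "I (sum f S) y = (\<Sum>x\<in>S. I (f x) y)"
proof (induction S rule: infinite_finite_induct)
qed (simp_all add: form_simps)

lemma orthogonal_sum: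
  assumes "finite S" "w \<in> S" "\<And>x. x \<in> S \<Longrightarrow> x \<noteq> w \<Longrightarrow> I (f x) (f w) = 0"
  shows "I (\<Sum>x\<in>S. u x *\<^sub>R f x) (f w) = u w * I (f w) (f w)"
proof -
  have "I (\<Sum>x\<in>S. u x *\<^sub>R f x) (f w) = (\<Sum>x\<in>S. if x = w then u w * I (f w) (f w) else 0)"
    unfolding form_sum_left by (rule sum.cong) (auto simp: form_simps assms)
  then show ?thesis using assms by (simp add: sum.delta)
qed

lemma orthogonal_independent:
  assumes "finite S" and "\<And>x. x \<in> S \<Longrightarrow> I x x \<noteq> 0"
    and "\<And>x y. x \<in> S \<Longrightarrow> y \<in> S \<Longrightarrow> x \<noteq> y \<Longrightarrow> I x y = 0"
  shows "independent S"
  unfolding dependent_finite[OF assms(1)]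
proof clarify
  fix u w assume z: "(\<Sum>v\<in>S. u v *\<^sub>R v) = 0" and w: "w \<in> S" "u w \<noteq> 0"
  have "I (\<Sum>v\<in>S. u v *\<^sub>R v) w = u w * I w w"
    using orthogonal_sum[of S w "\<lambda>x. x" u] assms w by blast
  then show False using z w assms by (simp add: form_simps)
qed

end

section \<open>Doubled roots and maximal orthogonal frames\<close>

locale nonreduced_roots = semidefinite_form I for I :: "'a::euclidean_space \<Rightarrow> 'a \<Rightarrow> real" +
  fixes R :: "'a set" and e0 :: 'a
  assumes nonisotropic: "x \<in> R \<Longrightarrow> I x x \<noteq> 0"
    and integral: "x \<in> R \<Longrightarrow> y \<in> R \<Longrightarrow> 2 * I x y / I x x \<in> \<int>"
    and reflect: "x \<in> R \<Longrightarrow> y \<in> R \<Longrightarrow> y - (2 * I x y / I x x) *\<^sub>R x \<in> R"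
    and irreducible: "R = R1 \<union> R2 \<Longrightarrow> (\<And>x y. x \<in> R1 \<Longrightarrow> y \<in> R2 \<Longrightarrow> I x y = 0) \<Longrightarrow> R1 = {} \<or> R2 = {}"
    and e0: "e0 \<in> R" "2 *\<^sub>R e0 \<in> R"
begin

lemma minus_root: "x \<in> R \<Longrightarrow> - x \<in> R"
  using reflect[of x x] nonisotropic[of x] by (simp add: scaleR_2)

lemma pos: "x \<in> R \<Longrightarrow> I x x > 0"
  using nonneg[of x] nonisotropic[of x] by linarith

text \<open>Integrality against \<open>2 *\<^sub>R x\<close> makes n = I(x,y)/I(x,x) an integer
  rather than a half-integer. With k = 2 I(x,y)/I(y,y), nonnegativity of I on y - n x squeezes 0 < n
  k \<le> 2. The value 2 is the case of equality, which puts y - n x into the radical; the value 1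
  leaves I(y,y) = 2 I(x,x).\<close>

lemma nonorthogonal_to_doubled_root:
  assumes x: "x \<in> R" "2 *\<^sub>R x \<in> R" and y: "y \<in> R" and n0: "I x y \<noteq> 0"
  obtains n where "n \<in> {1, -1, 2, -2}" "y - n *\<^sub>R x \<in> radical I"
  | s where "s \<in> {1, -1}" "I y y = 2 * I x x" "I x y = s * I x x"
proof -
  have cpos: "I x x > 0" and ypos: "I y y > 0" using pos x y by auto
  have "2 * I (2 *\<^sub>R x) y / I (2 *\<^sub>R x) (2 *\<^sub>R x) \<in> \<int>" using integral[OF x(2) y] .
  then have "I x y / I x x \<in> \<int>" by (simp add: form_simps field_simps)
  then obtain n :: int where n: "I x y = n * I x x" using cpos by (auto simp: Ints_def field_simps)
  obtain k :: int where k: "2 * I x y = k * I y y"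
    using integral[OF y x(1)] ypos by (auto simp: Ints_def field_simps sym[of y x])
  have nn: "I (y - n *\<^sub>R x) (y - n *\<^sub>R x) = I y y - n * n * I x x"
    by (simp add: form_simps n sym[of y x] algebra_simps)
  then have le: "n * n * I x x \<le> I y y" using nonneg[of "y - n *\<^sub>R x"] by simp
  have e: "2 * (n * n * I x x) = real_of_int (n * k) * I y y" using n k by (simp add: algebra_simps)
  have "n \<noteq> 0" using n n0 by auto
  then have "n * n > 0" by (metis not_square_less_zero linorder_neqE_linordered_idom mult_eq_0_iff)
  then have "real_of_int (n * n) > 0" by linarith
  then have "n * n * I x x > 0" using cpos by simp
  then have "real_of_int (n * k) * I y y > 0" using e by linarith
  then have p: "n * k > 0" using ypos by (metis of_int_0_less_iff zero_less_mult_pos2)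
  have "real_of_int (n * k) * I y y \<le> 2 * I y y" using e le by linarith
  then have "real_of_int (n * k) \<le> 2" using ypos by simp
  then have "n * k = 1 \<or> n * k = 2" using p by linarith
  then show thesis
  proof
    assume "n * k = 1"
    then have "n = 1 \<or> n = -1" by (metis zmult_eq_1_iff)
    moreover from this have "I y y = 2 * I x x" using e \<open>n * k = 1\<close> by (auto simp: algebra_simps)
    ultimately show thesis using that(2)[of "real_of_int n"] n by auto
  next
    assume nk: "n * k = 2"
    then have "\<bar>n\<bar> dvd 2" by (metis abs_dvd_iff dvd_triv_left)
    then have "\<bar>n\<bar> \<le> 2" using zdvd_imp_le by force
    then have "n = 1 \<or> n = -1 \<or> n = 2 \<or> n = -2" using \<open>n \<noteq> 0\<close> by linarith
    moreover have "2 * (n * n * I x x) = 2 * I y y" using e nk by simp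
    then have "y - n *\<^sub>R x \<in> radical I" using null nn by simp
    ultimately show thesis using that(1)[of "real_of_int n"] by auto
  qed
qed

definition q :: real where "q = I e0 e0"

lemma q_pos: "q > 0"
  using pos[OF e0(1)] by (simp add: q_def)

text \<open>The roots \<open>e0 - x\<close> are carried along because orthogonality alone does not
  connect the members: they later supply the transpositions that permute the frame.\<close>

definition frame :: "'a set \<Rightarrow> bool" where
  "frame S \<longleftrightarrow> finite S \<and> e0 \<in> S \<and>
     (\<forall>x\<in>S. x \<in> R \<and> 2 *\<^sub>R x \<in> R \<and> I x x = q \<and> (x \<noteq> e0 \<longrightarrow> e0 - x \<in> R)) \<and>
     (\<forall>x\<in>S. \<forall>y\<in>S. x \<noteq> y \<longrightarrow> I x y = 0)"

lemma frame_card: "frame S \<Longrightarrow> card S \<le> DIM('a)"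
proof -
  assume S: "frame S"
  have "independent S"
    by (rule orthogonal_independent) (use S q_pos in \<open>auto simp: frame_def\<close>)
  then show ?thesis using independent_bound[of S] by blast
qed

lemma maximal_frame: obtains S where "frame S" "\<And>S'. frame S' \<Longrightarrow> card S' \<le> card S"
proof -
  have "frame {e0}" using e0 by (simp add: frame_def q_def)
  then have "\<exists>S. frame S \<and> (\<forall>S'. frame S' \<longrightarrow> card S' \<le> card S)"
    by (rule ex_has_greatest_nat[of frame _ card "Suc DIM('a)"]) (simp add: frame_card less_Suc_eq_le)
  then show thesis using that by blast
qed

text \<open>If \<open>y\<close> has norm 2q, its reflection turns \<open>t\<close> into a doubled
  root t' orthogonal to \<open>t\<close>. Either t' agrees with another frame member up to sign and
  radical, which expresses \<open>y\<close> by two members, or t' enlarges the frame against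
  maximality.\<close>

lemma maximal_frame_root:
  assumes S: "frame S" and max: "\<And>S'. frame S' \<Longrightarrow> card S' \<le> card S"
    and y: "y \<in> R" and t: "t \<in> S" "I t y \<noteq> 0"
  shows "(\<exists>n\<in>{1, -1, 2, -2}. y - n *\<^sub>R t \<in> radical I) \<or>
    (\<exists>u\<in>S. \<exists>s\<in>{1, -1}. \<exists>s'\<in>{1, -1}. u \<noteq> t \<and> y - s *\<^sub>R t - s' *\<^sub>R u \<in> radical I)"
proof -
  have tR: "t \<in> R" "2 *\<^sub>R t \<in> R" and tc: "I t t = q" using S t by (auto simp: frame_def)
  note c = q_pos
  show ?thesis
  proof (rule nonorthogonal_to_doubled_root[OF tR y t(2)])
    fix n assume "n \<in> {1, -1, 2, -2::real}" "y - n *\<^sub>R t \<in> radical I"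
    then show ?thesis by (intro disjI1 bexI[of _ n])
  next
    fix s :: real assume s: "s \<in> {1, -1}" and yy: "I y y = 2 * I t t" and ty: "I t y = s * I t t"
    have ss: "s * s = 1" using s by auto
    define t' where "t' = t - s *\<^sub>R y"
    have sy: "s *\<^sub>R y = t - t'" and y': "y = s *\<^sub>R t - s *\<^sub>R t'"
      using ss by (auto simp: t'_def algebra_simps)
    have coef: "2 * I y t / I y y = s" using ty yy c tc by (simp add: sym[of y t] field_simps)
    have "t' \<in> R" using reflect[OF y tR(1)] unfolding coef t'_def .
    moreover have "2 *\<^sub>R t' \<in> R"
    proof -
      have "2 * I y (2 *\<^sub>R t) / I y y = 2 * s" using coef by (simp add: form_simps)
      then show ?thesis using reflect[OF y tR(2)] by (simp add: t'_def algebra_simps)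
    qed
    moreover have "I t' t' = q"
      using ss ty yy tc by (simp add: t'_def form_simps sym[of y t] algebra_simps)
    moreover have ortht: "I t t' = 0"
      using ss ty tc by (simp add: t'_def form_simps)
    ultimately have t': "t' \<in> R" "2 *\<^sub>R t' \<in> R" "I t' t' = q" "I t t' = 0" by auto
    have syR: "s *\<^sub>R y \<in> R" using s y minus_root by auto
    show ?thesis
    proof (cases "\<exists>u\<in>S. I u t' \<noteq> 0")
      case True
      then obtain u where u: "u \<in> S" "I u t' \<noteq> 0" by auto
      then have uR: "u \<in> R" "2 *\<^sub>R u \<in> R" "I u u = q" using S by (auto simp: frame_def)
      have "u \<noteq> t" using u t' by auto
      \<comment> \<open>Both vectors have norm q, which excludes the alternative with ratio 2 and
        afterwards forces n to be 1 or -1.\<close>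
      obtain n where "n \<in> {1, -1, 2, -2}" and n: "t' - n *\<^sub>R u \<in> radical I"
        using uR(3) t'(3) c by (rule_tac nonorthogonal_to_doubled_root[OF uR(1,2) t'(1) u(2)]) auto
      have "I t' t' = I (n *\<^sub>R u) (n *\<^sub>R u)"
        using radical_left[OF n, of t'] radical_right[OF n, of "n *\<^sub>R u"] by (simp add: form_simps)
      then have "n * n = 1" using t' uR c by (simp add: form_simps)
      then have n': "n = 1 \<or> n = -1" using square_eq_1_iff by blast
      have "y - s *\<^sub>R t - (-s * n) *\<^sub>R u = (-s) *\<^sub>R (t' - n *\<^sub>R u)"
        by (simp add: y' algebra_simps)
      then have "y - s *\<^sub>R t - (-s * n) *\<^sub>R u \<in> radical I"
        using subspace_scale[OF subspace_radical n] by metis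
      moreover have "-s * n \<in> {1, -1}" using s n' by auto
      ultimately show ?thesis using u \<open>u \<noteq> t\<close> s by blast
    next
      case False
      then have orth: "I u t' = 0" if "u \<in> S" for u using that by auto
      then have orth': "I t' u = 0" if "u \<in> S" for u using that by (simp add: sym[of t' u])
      have diff: "e0 - t' \<in> R"
      proof (cases "t = e0")
        case True
        then show ?thesis using syR sy by simp
      next
        case False
        then have d: "e0 - t \<in> R" and o: "I e0 t = 0" using S t by (auto simp: frame_def)
        \<comment> \<open>With this coefficient the reflection in e0 - t sends s y = t - t' to (t -
          t') + (e0 - t) = e0 - t', the root that links t' to e0.\<close>
        have "2 * I (e0 - t) (t - t') / I (e0 - t) (e0 - t) = -1"
          using o orth[of e0] S t' tc c
          by (simp add: form_simps sym[of t e0] frame_def field_simps)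
        then show ?thesis using reflect[OF d syR] unfolding sy by simp
      qed
      have "t' \<noteq> e0" using orth[of e0] S c by (auto simp: frame_def)
      have "t' \<notin> S" using orth[of t'] t' c by auto
      have "frame (insert t' S)"
        using S t' diff orth orth' unfolding frame_def by simp
      from max[OF this] \<open>t' \<notin> S\<close> S show ?thesis by (simp add: frame_def)
    qed
  qed
qed

text \<open>Roots meeting the frame are combinations of its members modulo the radical, hence
  orthogonal to every root that misses it. Irreducibility leaves only one of the two kinds, and e0
  is of the first.\<close>

lemma roots_in_maximal_frame:
  assumes S: "frame S" and max: "\<And>S'. frame S' \<Longrightarrow> card S' \<le> card S" and y: "y \<in> R"
  shows "\<exists>t\<in>S. I t y \<noteq> 0"
proof -
  let ?R1 = "{y\<in>R. \<exists>t\<in>S. I t y \<noteq> 0}" and ?R2 = "{y\<in>R. \<forall>t\<in>S. I t y = 0}"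
  have "I x y = 0" if x: "x \<in> ?R1" and y: "y \<in> ?R2" for x y
  proof -
    obtain t where t: "t \<in> S" "I t x \<noteq> 0" using x by auto
    have *: "I z y = 0 \<Longrightarrow> x - z \<in> radical I \<Longrightarrow> I x y = 0" for z
      using radical_left[of "x - z" y] by (simp add: form_simps)
    have o: "I u y = 0" if "u \<in> S" for u using that y by auto
    from maximal_frame_root[OF S max _ t] x consider
      (a) n where "x - n *\<^sub>R t \<in> radical I"
      | (b) u s s' where "u \<in> S" "x - s *\<^sub>R t - s' *\<^sub>R u \<in> radical I" by blast
    then show ?thesis
    proof cases
      case a then show ?thesis using *[of "n *\<^sub>R t"] o t by (simp add: form_simps)
    next
      case b then show ?thesis using *[of "s *\<^sub>R t + s' *\<^sub>R u"] o t by (simp add: form_simps algebra_simps)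
    qed
  qed
  moreover have "R = ?R1 \<union> ?R2" by auto
  ultimately have "?R1 = {} \<or> ?R2 = {}" using irreducible[of ?R1 ?R2] by blast
  moreover have "e0 \<in> S" using S by (simp add: frame_def)
  then have "e0 \<in> ?R1" using e0(1) nonisotropic[OF e0(1)] by blast
  ultimately show ?thesis using y by blast
qed

end

section \<open>A maximal orthogonal frame\<close>

locale framed_roots = nonreduced_roots I R e0
  for I :: "'a::euclidean_space \<Rightarrow> 'a \<Rightarrow> real" and R e0 +
  fixes l :: nat and e :: "nat \<Rightarrow> 'a"
  assumes l: "l > 0" and e_0: "e 0 = e0"
    and e_root: "i < l \<Longrightarrow> e i \<in> R" and e_double: "i < l \<Longrightarrow> 2 *\<^sub>R e i \<in> R"
    and e_norm: "i < l \<Longrightarrow> I (e i) (e i) = q"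
    and e_orth: "i < l \<Longrightarrow> j < l \<Longrightarrow> i \<noteq> j \<Longrightarrow> I (e i) (e j) = 0"
    and e0_diff: "i < l \<Longrightarrow> i \<noteq> 0 \<Longrightarrow> e 0 - e i \<in> R"
    and root_shape: "y \<in> R \<Longrightarrow>
      \<exists>v \<in> BCs l \<union> BCm l \<union> BCl l. \<exists>d \<in> radical I. y = (\<Sum>i<l. v i *\<^sub>R e i) + d"

context nonreduced_roots
begin

lemma sum_single: "i < (l::nat) \<Longrightarrow> (\<Sum>k<l. (if k = i then s else 0) *\<^sub>R (e k :: 'a)) = s *\<^sub>R e i"
proof -
  assume i: "i < l"
  have "(\<Sum>k<l. (if k = i then s else 0) *\<^sub>R e k) = (\<Sum>k<l. if k = i then s *\<^sub>R e i else 0)"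
    by (rule sum.cong) auto
  then show ?thesis using i by simp
qed

lemma sum_pair:
  assumes "i < (l::nat)" "j < l" "i \<noteq> j"
  shows "(\<Sum>k<l. (if k = i then s else if k = j then t else 0) *\<^sub>R (e k :: 'a)) = s *\<^sub>R e i + t *\<^sub>R e j"
proof -
  have "(\<Sum>k<l. (if k = i then s else if k = j then t else 0) *\<^sub>R e k) =
    (\<Sum>k<l. (if k = i then s else 0) *\<^sub>R e k + (if k = j then t else 0) *\<^sub>R e k)"
    by (rule sum.cong) (use assms in auto)
  then show ?thesis using assms by (simp only: sum.distrib sum_single)
qed

text \<open>The span of the frame and the radical are complementary, so counting dimensions gives
  exactly l members.\<close>

lemma frame_enumeration:
  assumes dim: "DIM('a) = l + 2" and rad: "dim (radical I) = 2" and full: "span R = UNIV"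
  obtains e where "framed_roots I R e0 l e"
proof -
  obtain S where S: "frame S" and max: "\<And>S'. frame S' \<Longrightarrow> card S' \<le> card S"
    using maximal_frame by blast
  have fin: "finite S" and S0: "e0 \<in> S" using S by (auto simp: frame_def)
  have ind: "independent S"
    by (rule orthogonal_independent) (use S q_pos in \<open>auto simp: frame_def\<close>)
  have shape: "(\<exists>t\<in>S. \<exists>n\<in>{1, -1, 2, -2}. y - n *\<^sub>R t \<in> radical I) \<or>
    (\<exists>t\<in>S. \<exists>u\<in>S. \<exists>s\<in>{1, -1}. \<exists>s'\<in>{1, -1}. u \<noteq> t \<and> y - s *\<^sub>R t - s' *\<^sub>R u \<in> radical I)"
    if y: "y \<in> R" for y
  proof -
    obtain t where t: "t \<in> S" "I t y \<noteq> 0" using roots_in_maximal_frame[OF S max y] by blast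
    show ?thesis using maximal_frame_root[OF S max y t] t(1) by blast
  qed
  let ?W = "{x + y |x y. x \<in> span S \<and> y \<in> radical I}"
  have W: "subspace ?W" using subspace_sums[OF subspace_span subspace_radical] .
  have WI: "y \<in> ?W" if "x \<in> span S" "y - x \<in> radical I" for x y
    using that by (intro CollectI exI[of _ x] exI[of _ "y - x"]) simp
  have "R \<subseteq> ?W"
  proof
    fix y assume "y \<in> R"
    from shape[OF this] consider
      (a) t n where "t \<in> S" "y - n *\<^sub>R t \<in> radical I"
      | (b) t u s s' where "t \<in> S" "u \<in> S" "y - s *\<^sub>R t - s' *\<^sub>R u \<in> radical I" by blast
    then show "y \<in> ?W"
    proof cases
      case a
      then show ?thesis by (intro WI[of "n *\<^sub>R t"]) (auto intro: span_mul span_base)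
    next
      case b
      then show ?thesis
        by (intro WI[of "s *\<^sub>R t + s' *\<^sub>R u"])
          (simp_all add: span_mul span_base span_add diff_diff_eq)
    qed
  qed
  then have "?W = UNIV" using full W span_minimal by blast
  moreover have "span S \<inter> radical I \<subseteq> {0}"
  proof clarify
    fix x assume "x \<in> span S" and r: "x \<in> radical I"
    then obtain w where x: "x = (\<Sum>v\<in>S. w v *\<^sub>R v)" using span_finite[OF fin] by auto
    have "w v = 0" if v: "v \<in> S" for v
    proof -
      have "I x v = w v * I v v"
        unfolding x by (rule orthogonal_sum[of S v "\<lambda>x. x" w]) (use fin v S in \<open>auto simp: frame_def\<close>)
      then show ?thesis using v S q_pos radical_left[OF r] by (auto simp: frame_def)
    qed
    then show "x = 0" by (simp add: x)
  qed
  then have d0: "dim (span S \<inter> radical I) = 0" by simp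
  ultimately have "card S = l"
    using dim_sums_Int[OF subspace_span[of S] subspace_radical] dim rad
      dim_eq_card_independent[OF ind] d0 by simp
  then have "card (S - {e0}) = l - 1" and lpos: "l > 0"
    using S0 fin card_gt_0_iff by auto
  then obtain h where h: "bij_betw h {0..<l - 1} (S - {e0})"
    using ex_bij_betw_nat_finite[of "S - {e0}"] fin by auto
  \<comment> \<open>Index 0 is reserved for e0; \<open>h\<close> enumerates the remaining l - 1
    members, shifted by one.\<close>
  define e where "e i = (case i of 0 \<Rightarrow> e0 | Suc k \<Rightarrow> h k)" for i
  have hS: "h i \<in> S - {e0}" if "i < l - 1" for i using h that by (auto simp: bij_betw_def)
  have e1: "e i \<in> S" if "i < l" for i using that hS S0 by (auto simp: e_def split: nat.split)
  have einj: "e i \<noteq> e j" if "i < l" "j < l" "i \<noteq> j" for i j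
  proof -
    have "inj_on h {0..<l - 1}" using h by (simp add: bij_betw_def)
    moreover have "e0 \<noteq> h k" if "k < l - 1" for k using hS[OF that] by auto
    ultimately show ?thesis using that
      by (cases i; cases j) (simp_all add: e_def inj_on_eq_iff eq_commute[of _ e0] less_diff_conv)
  qed
  have esurj: "\<exists>i<l. t = e i" if "t \<in> S" for t
  proof (cases "t = e0")
    case False
    then have "t \<in> h ` {0..<l - 1}" using h \<open>t \<in> S\<close> by (simp add: bij_betw_def)
    then obtain i where "i < l - 1" "t = h i" by auto
    then show ?thesis by (intro exI[of _ "Suc i"]) (auto simp: e_def)
  qed (use lpos in \<open>auto simp: e_def\<close>)
  have e_0: "e 0 = e0" by (simp add: e_def)
  have "framed_roots I R e0 l e"
  proof unfold_locales
    fix y assume "y \<in> R"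
    from shape[OF this] consider
      (a) t n where "t \<in> S" "n \<in> {1, -1, 2, -2}" "y - n *\<^sub>R t \<in> radical I"
      | (b) t u s s' where "t \<in> S" "u \<in> S" "s \<in> {1,-1}" "s' \<in> {1,-1}" "u \<noteq> t"
        "y - s *\<^sub>R t - s' *\<^sub>R u \<in> radical I" by blast
    then show "\<exists>v \<in> BCs l \<union> BCm l \<union> BCl l. \<exists>d \<in> radical I. y = (\<Sum>i<l. v i *\<^sub>R e i) + d"
    proof cases
      case a
      obtain i where i: "i < l" "t = e i" using esurj a by blast
      have "(\<lambda>k. if k = i then n else 0) \<in> BCs l \<union> BCm l \<union> BCl l"
        using a i unfolding BCs_def BCl_def by auto
      then show ?thesis
        by (rule bexI[rotated], intro bexI[OF _ a(3)]) (simp only: sum_single[OF i(1)] i(2), simp)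
    next
      case b
      obtain i j where ij: "i < l" "t = e i" "j < l" "u = e j" using esurj b by metis
      then have "i \<noteq> j" using b by auto
      have "\<exists>i j s s'. i < j \<and> j < l \<and> s \<in> {1,-1} \<and> s' \<in> {1,-1} \<and> y - s *\<^sub>R e i - s' *\<^sub>R e j \<in> radical I"
      proof (cases "i < j")
        case True then show ?thesis using ij b by blast
      next
        case False
        then have "j < i" "y - s' *\<^sub>R e j - s *\<^sub>R e i \<in> radical I"
          using \<open>i \<noteq> j\<close> b ij by (auto simp: algebra_simps)
        then show ?thesis using ij b by blast
      qed
      then obtain i j s s' where *: "i < j" "j < l" "s \<in> {1,-1}" "s' \<in> {1,-1}"
        and d: "y - s *\<^sub>R e i - s' *\<^sub>R e j \<in> radical I" by blast
      let ?v = "\<lambda>k. if k = i then s else if k = j then s' else 0"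
      have "?v \<in> BCs l \<union> BCm l \<union> BCl l"
        using * unfolding BCm_def by auto
      moreover have "i < l" "i \<noteq> j" using * by auto
      then have "y = (\<Sum>k<l. ?v k *\<^sub>R e k) + (y - s *\<^sub>R e i - s' *\<^sub>R e j)"
        using * by (subst sum_pair) simp_all
      ultimately show ?thesis by (intro bexI[of _ ?v] bexI[OF _ d])
    qed
  qed (use e1 einj einj[of _ 0] S lpos e_0 in \<open>auto simp: frame_def\<close>)
  then show thesis using that by blast
qed

end

section \<open>Fibres over the finite root system\<close>

context framed_roots
begin

lemma flip: "i < l \<Longrightarrow> x \<in> R \<Longrightarrow> x - (2 * I x (e i) / q) *\<^sub>R e i \<in> R"
  using reflect[OF e_root[of i], of x] by (simp add: e_norm sym[of x])

lemma flip_coeff: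
  assumes i: "i < l" and x: "s *\<^sub>R e i + y \<in> R" and y: "I y (e i) = 0"
  shows "(- s) *\<^sub>R e i + y \<in> R"
proof -
  have c: "2 * I (s *\<^sub>R e i + y) (e i) / q = 2 * s"
    using i y q_pos by (simp add: form_simps e_norm)
  have "s *\<^sub>R e i + y - (2 * s) *\<^sub>R e i = (- s) *\<^sub>R e i + y"
    by (simp add: scaleR_2 flip: scaleR_scaleR)
  then show ?thesis using flip[OF i x] unfolding c by (simp only:)
qed

text \<open>The reflection in e0 - e_i carries e0 - e_j to e_i - e_j.\<close>

lemma diff_root:
  assumes "i < l" "j < l" "i \<noteq> j"
  shows "e i - e j \<in> R"
proof -
  consider "i = 0" | "j = 0" "i \<noteq> 0" | "i \<noteq> 0" "j \<noteq> 0" by auto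
  then show ?thesis
  proof cases
    case 1
    then show ?thesis using e0_diff assms by simp
  next
    case 2
    then show ?thesis using minus_root[OF e0_diff[of i]] assms by simp
  next
    case 3
    have "2 * I (e 0 - e i) (e 0 - e j) / I (e 0 - e i) (e 0 - e i) = 1"
      using assms 3 l q_pos by (simp add: form_simps e_norm e_orth)
    then show ?thesis using reflect[OF e0_diff[of i] e0_diff[of j]] assms 3 by simp
  qed
qed

lemma swap_coeffs:
  assumes ij: "i < l" "j < l" "i \<noteq> j" and x: "s *\<^sub>R e i + t *\<^sub>R e j + y \<in> R"
    and y: "I y (e i) = 0" "I y (e j) = 0"
  shows "t *\<^sub>R e i + s *\<^sub>R e j + y \<in> R"
proof -
  have "2 * I (e i - e j) (s *\<^sub>R e i + t *\<^sub>R e j + y) / I (e i - e j) (e i - e j) = s - t"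
    using ij y q_pos
    by (simp add: form_simps e_norm e_orth sym[of "e i" y] sym[of "e j" y] field_simps)
  moreover have "s *\<^sub>R e i + t *\<^sub>R e j + y - (s - t) *\<^sub>R (e i - e j) = t *\<^sub>R e i + s *\<^sub>R e j + y"
    by (simp add: algebra_simps)
  ultimately show ?thesis using reflect[OF diff_root[OF ij] x] by (simp only:)
qed

lemma axis_root_iff:
  assumes i: "i < l" and d: "d \<in> radical I" and s: "s = r \<or> s = - r"
  shows "s *\<^sub>R e i + d \<in> R \<longleftrightarrow> r *\<^sub>R e0 + d \<in> R"
proof -
  have f: "(- t) *\<^sub>R e k + d \<in> R" if "t *\<^sub>R e k + d \<in> R" "k < l" for t k
    using flip_coeff[OF that(2,1)] radical_left[OF d] by simp
  have "r *\<^sub>R e j + d \<in> R" if "r *\<^sub>R e k + d \<in> R" "k < l" "j < l" for j k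
  proof (cases "j = k")
    case False
    then show ?thesis
      using swap_coeffs[of k j r 0 d] that radical_left[OF d] by simp
  qed (use that in simp)
  then have "r *\<^sub>R e i + d \<in> R \<longleftrightarrow> r *\<^sub>R e 0 + d \<in> R" using i l by blast
  moreover have "s *\<^sub>R e i + d \<in> R \<longleftrightarrow> r *\<^sub>R e i + d \<in> R"
    using s f[of r i] f[of "- r" i] i by auto
  ultimately show ?thesis by (simp add: e_0)
qed

text \<open>Sign changes and transpositions of the frame act transitively on the middle vectors and
  fix the radical pointwise, so all these vectors share one fibre.\<close>

lemma pair_root_iff:
  assumes ij: "i < l" "j < l" "i \<noteq> j" and d: "d \<in> radical I"
    and s: "s = 1 \<or> s = -1" and t: "t = 1 \<or> t = -1"
  shows "s *\<^sub>R e i + t *\<^sub>R e j + d \<in> R \<longleftrightarrow> e 0 - e 1 + d \<in> R"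
proof -
  let ?P = "\<lambda>s i t j. s *\<^sub>R e i + t *\<^sub>R e j + d \<in> R"
  have com: "?P s i t j \<longleftrightarrow> ?P t j s i" for s t :: real and i j by (simp add: algebra_simps)
  have f1: "?P s i t j \<Longrightarrow> ?P (- s) i t j" if "i < l" "j < l" "i \<noteq> j" for s t :: real and i j
    using flip_coeff[of i s "t *\<^sub>R e j + d"] that radical_left[OF d]
    by (simp add: form_simps e_orth algebra_simps)
  have sgn: "?P s i t j \<longleftrightarrow> ?P 1 i (-1) j"
    if "i < l" "j < l" "i \<noteq> j" "s = 1 \<or> s = -1" "t = 1 \<or> t = -1" for s t :: real and i j
    using that(4,5) f1[OF that(1-3)] f1[OF that(2,1) that(3)[symmetric]] com[of 1 i] com[of "-1" i]
    by (metis minus_minus)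
  have repl: "?P 1 k (-1) j" if "?P 1 i (-1) j" "i < l" "j < l" "k < l" "i \<noteq> j" "k \<noteq> j" for i j k
  proof (cases "i = k")
    case False
    have "1 *\<^sub>R e i + 0 *\<^sub>R e k + ((-1) *\<^sub>R e j + d) \<in> R" using that by (simp add: algebra_simps)
    from swap_coeffs[OF _ _ False this] that show ?thesis
      by (simp add: form_simps e_orth radical_left[OF d] algebra_simps)
  qed (use that in simp)
  have flipij: "?P 1 j (-1) i" if "?P 1 i (-1) j" "i < l" "j < l" "i \<noteq> j" for i j
    using that sgn[of i j "-1" 1] com[of "-1" i 1 j] by simp
  have repl2: "?P 1 i (-1) k" if "?P 1 i (-1) j" "i < l" "j < l" "k < l" "i \<noteq> j" "i \<noteq> k" for i j k
    using flipij[OF repl[OF flipij[OF that(1-3,5)], of k]] that by blast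
  have main: "?P 1 i' (-1) j'"
    if P: "?P 1 i (-1) j" and b: "i < l" "j < l" "i' < l" "j' < l" "i \<noteq> j" "i' \<noteq> j'" for i j i' j'
  proof (cases "j' = i")
    case False
    then show ?thesis using repl[OF repl2[OF P]] b by blast
  next
    case True
    \<comment> \<open>Replacing j by j' first would make the two indices collide, so they are
      exchanged beforehand.\<close>
    have "?P 1 j (-1) i" using flipij P b by blast
    then show ?thesis using repl[of j i i'] True b by blast
  qed
  have "0 < l" "1 < l" using ij by auto
  then have "?P 1 i (-1) j \<longleftrightarrow> ?P 1 0 (-1) 1" using main ij by (metis zero_neq_one)
  then show ?thesis using sgn[OF ij s t] by simp
qed

text \<open>\<open>A\<close>, \<open>B\<close>, \<open>C\<close> are the fibres over one
  representative of each Weyl orbit. \<open>B\<close> has its intended meaning for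
  \<open>l \<ge> 2\<close>, where \<open>e 1\<close> belongs to the frame.\<close>

definition A where "A = {d \<in> radical I. e 0 + d \<in> R}"
definition B where "B = {d \<in> radical I. e 0 - e 1 + d \<in> R}"
definition C where "C = {d \<in> radical I. 2 *\<^sub>R e 0 + d \<in> R}"

lemma sum_mem_iff:
  assumes d: "d \<in> radical I"
  shows "v \<in> BCs l \<Longrightarrow> (\<Sum>i<l. v i *\<^sub>R e i) + d \<in> R \<longleftrightarrow> d \<in> A"
    and "v \<in> BCm l \<Longrightarrow> (\<Sum>i<l. v i *\<^sub>R e i) + d \<in> R \<longleftrightarrow> d \<in> B"
    and "v \<in> BCl l \<Longrightarrow> (\<Sum>i<l. v i *\<^sub>R e i) + d \<in> R \<longleftrightarrow> d \<in> C"
proof -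
  assume "v \<in> BCs l"
  then obtain i s where v: "v = (\<lambda>k. if k = i then s else 0)" "i < l" "s = 1 \<or> s = -1"
    unfolding BCs_def by blast
  then show "(\<Sum>i<l. v i *\<^sub>R e i) + d \<in> R \<longleftrightarrow> d \<in> A"
    using axis_root_iff[of i d s 1] d by (simp only: v(1) sum_single) (simp add: A_def e_0)
next
  assume "v \<in> BCl l"
  then obtain i s where v: "v = (\<lambda>k. if k = i then s else 0)" "i < l" "s = 2 \<or> s = -2"
    unfolding BCl_def by blast
  then show "(\<Sum>i<l. v i *\<^sub>R e i) + d \<in> R \<longleftrightarrow> d \<in> C"
    using axis_root_iff[of i d s 2] d by (simp only: v(1) sum_single) (simp add: C_def e_0)
next
  assume "v \<in> BCm l"
  then obtain i j s t where v: "v = (\<lambda>k. if k = i then s else if k = j then t else 0)"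
    "i < j" "j < l" "s = 1 \<or> s = -1" "t = 1 \<or> t = -1"
    unfolding BCm_def by blast
  then have "i < l" "i \<noteq> j" by auto
  then show "(\<Sum>i<l. v i *\<^sub>R e i) + d \<in> R \<longleftrightarrow> d \<in> B"
    unfolding v(1) using pair_root_iff[of i j d s t] d v(2-)
    by (subst sum_pair) (simp_all add: B_def)
qed

section \<open>Closure of the fibres under single reflections\<close>

lemma reflect_coeff:
  assumes "x \<in> R" "y \<in> R" "2 * I x y = k * I x x"
  shows "y - k *\<^sub>R x \<in> R"
  using reflect[OF assms(1,2)] nonisotropic[OF assms(1)] unfolding assms(3) by simp

lemma A_rad: "A \<subseteq> radical I" and B_rad: "B \<subseteq> radical I" and C_rad: "C \<subseteq> radical I"
  by (auto simp: A_def B_def C_def)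

lemma radical_comb: "x \<in> radical I \<Longrightarrow> y \<in> radical I \<Longrightarrow> x + k *\<^sub>R y \<in> radical I"
  using subspace_radical by (simp add: subspace_add subspace_scale)

lemma radical_sub: "x \<in> radical I \<Longrightarrow> y \<in> radical I \<Longrightarrow> x - y \<in> radical I"
  using subspace_radical by (simp add: subspace_diff)

lemma radical_sub_scale: "x \<in> radical I \<Longrightarrow> y \<in> radical I \<Longrightarrow> x - k *\<^sub>R y \<in> radical I"
  using subspace_radical by (simp add: subspace_diff subspace_scale)

lemmas rad_simps = radical_left radical_right radical_comb radical_sub radical_sub_scale
  subspace_add[OF subspace_radical]

lemma zero_mem: "0 \<in> A" "l \<ge> 2 \<Longrightarrow> 0 \<in> B" "0 \<in> C"
  using e_root e_double l diff_root[of 0 1] subspace_0[OF subspace_radical]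
  by (auto simp: A_def B_def C_def)

lemma axis_root:
  assumes "i < l" "d \<in> radical I"
  shows "e i + d \<in> R \<longleftrightarrow> d \<in> A" "- e i + d \<in> R \<longleftrightarrow> d \<in> A"
    "2 *\<^sub>R e i + d \<in> R \<longleftrightarrow> d \<in> C" "(-2) *\<^sub>R e i + d \<in> R \<longleftrightarrow> d \<in> C"
  using axis_root_iff[OF assms, of 1 1] axis_root_iff[OF assms, of "-1" 1]
    axis_root_iff[OF assms, of 2 2] axis_root_iff[OF assms, of "-2" 2] assms(2)
  by (simp_all add: A_def C_def e_0)

lemma pair_root:
  assumes "i < l" "j < l" "i \<noteq> j" "d \<in> radical I"
  shows "e i - e j + d \<in> R \<longleftrightarrow> d \<in> B" "- e i - e j + d \<in> R \<longleftrightarrow> d \<in> B"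
  using pair_root_iff[OF assms, of 1 "-1"] pair_root_iff[OF assms, of "-1" "-1"] assms(4)
  by (simp_all add: B_def)

text \<open>Reflecting \<open>e 0 + x\<close> in \<open>e 0 + y\<close> lands over
  \<open>- e 0\<close> with radical part x - 2y. Each of the following closure rules comes in the
  same way from one reflection, its coefficient being the Cartan integer of the two finite
  parts.\<close>

lemma A_A: assumes "x \<in> A" "y \<in> A" shows "x - 2 *\<^sub>R y \<in> A"
proof -
  have rad: "x \<in> radical I" "y \<in> radical I" using assms A_rad by auto
  have "(e 0 + x) - 2 *\<^sub>R (e 0 + y) \<in> R"
    by (rule reflect_coeff) (use assms rad l in \<open>simp_all add: axis_root form_simps rad_simps\<close>)
  also have "(e 0 + x) - 2 *\<^sub>R (e 0 + y) = - e 0 + (x - 2 *\<^sub>R y)"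
    by (simp add: algebra_simps scaleR_2)
  finally show ?thesis using l rad by (simp only: axis_root rad_simps)
qed

lemma C_A: assumes "x \<in> C" "y \<in> A" shows "x - 4 *\<^sub>R y \<in> C"
proof -
  have rad: "x \<in> radical I" "y \<in> radical I" using assms A_rad C_rad by auto
  have "(2 *\<^sub>R e 0 + x) - 4 *\<^sub>R (e 0 + y) \<in> R"
    by (rule reflect_coeff) (use assms rad l in \<open>simp_all add: axis_root form_simps rad_simps\<close>)
  also have "(2 *\<^sub>R e 0 + x) - 4 *\<^sub>R (e 0 + y) = (-2) *\<^sub>R e 0 + (x - 4 *\<^sub>R y)"
    by (simp add: algebra_simps flip: scaleR_add_left)
  finally show ?thesis using l rad by (simp only: axis_root rad_simps)
qed

lemma A_C: assumes "x \<in> A" "y \<in> C" shows "x - y \<in> A"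
proof -
  have rad: "x \<in> radical I" "y \<in> radical I" using assms A_rad C_rad by auto
  have "(e 0 + x) - 1 *\<^sub>R (2 *\<^sub>R e 0 + y) \<in> R"
    by (rule reflect_coeff) (use assms rad l in \<open>simp_all add: axis_root form_simps rad_simps\<close>)
  also have "(e 0 + x) - 1 *\<^sub>R (2 *\<^sub>R e 0 + y) = - e 0 + (x - y)"
    by (simp add: algebra_simps scaleR_2)
  finally show ?thesis using l rad by (simp only: axis_root rad_simps)
qed

lemma C_C: assumes "x \<in> C" "y \<in> C" shows "x - 2 *\<^sub>R y \<in> C"
proof -
  have rad: "x \<in> radical I" "y \<in> radical I" using assms C_rad by auto
  have "(2 *\<^sub>R e 0 + x) - 2 *\<^sub>R (2 *\<^sub>R e 0 + y) \<in> R"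
    by (rule reflect_coeff) (use assms rad l in \<open>simp_all add: axis_root form_simps rad_simps\<close>)
  also have "(2 *\<^sub>R e 0 + x) - 2 *\<^sub>R (2 *\<^sub>R e 0 + y) = (-2) *\<^sub>R e 0 + (x - 2 *\<^sub>R y)"
    by (simp add: algebra_simps flip: scaleR_add_left)
  finally show ?thesis using l rad by (simp only: axis_root rad_simps)
qed

lemma A_B: assumes "l \<ge> 2" "x \<in> A" "y \<in> B" shows "x + y \<in> A"
proof -
  have rad: "x \<in> radical I" "y \<in> radical I" using assms A_rad B_rad by auto
  have "(e 1 + x) - (-1) *\<^sub>R (e 0 - e 1 + y) \<in> R"
    by (rule reflect_coeff)
      (use assms rad in \<open>simp_all add: axis_root pair_root form_simps rad_simps e_norm e_orth\<close>)
  also have "(e 1 + x) - (-1) *\<^sub>R (e 0 - e 1 + y) = e 0 + (x + y)"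
    by (simp add: algebra_simps scaleR_2)
  finally show ?thesis using l rad by (simp only: axis_root rad_simps)
qed

lemma B_A: assumes "l \<ge> 2" "x \<in> B" "y \<in> A" shows "x - 2 *\<^sub>R y \<in> B"
proof -
  have rad: "x \<in> radical I" "y \<in> radical I" using assms A_rad B_rad by auto
  have "(e 0 - e 1 + x) - 2 *\<^sub>R (e 0 + y) \<in> R"
    by (rule reflect_coeff)
      (use assms rad in \<open>simp_all add: axis_root pair_root form_simps rad_simps e_norm e_orth\<close>)
  also have "(e 0 - e 1 + x) - 2 *\<^sub>R (e 0 + y) = - e 0 - e 1 + (x - 2 *\<^sub>R y)"
    by (simp add: algebra_simps scaleR_2)
  finally show ?thesis using assms(1) rad by (subst (asm) pair_root) (simp_all add: rad_simps)
qed

text \<open>Three indices are essential: e_0 - e_1 and e_1 - e_2 are middle vectors whose sum is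
  again one. For l = 2 any two middle vectors are parallel or orthogonal, which is why
  \<open>B\<close> may fail to be a group there.\<close>

lemma B_add: assumes "l \<ge> 3" "x \<in> B" "y \<in> B" shows "x + y \<in> B"
proof -
  have rad: "x \<in> radical I" "y \<in> radical I" using assms B_rad by auto
  have "(e 0 - e 1 + x) - (-1) *\<^sub>R (e 1 - e 2 + y) \<in> R"
    by (rule reflect_coeff)
      (use assms rad in \<open>simp_all add: pair_root form_simps rad_simps e_norm e_orth\<close>)
  also have "(e 0 - e 1 + x) - (-1) *\<^sub>R (e 1 - e 2 + y) = e 0 - e 2 + (x + y)"
    by (simp add: algebra_simps)
  finally show ?thesis using assms(1) rad by (subst (asm) pair_root) (simp_all add: rad_simps)
qed

lemma C_B: assumes "l \<ge> 2" "x \<in> C" "y \<in> B" shows "x + 2 *\<^sub>R y \<in> C"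
proof -
  have rad: "x \<in> radical I" "y \<in> radical I" using assms C_rad B_rad by auto
  have "(2 *\<^sub>R e 1 + x) - (-2) *\<^sub>R (e 0 - e 1 + y) \<in> R"
    by (rule reflect_coeff)
      (use assms rad in \<open>simp_all add: axis_root pair_root form_simps rad_simps e_norm e_orth\<close>)
  also have "(2 *\<^sub>R e 1 + x) - (-2) *\<^sub>R (e 0 - e 1 + y) = 2 *\<^sub>R e 0 + (x + 2 *\<^sub>R y)"
    by (simp add: algebra_simps)
  finally show ?thesis using l rad by (simp only: axis_root rad_simps)
qed

lemma B_C: assumes "l \<ge> 2" "x \<in> B" "y \<in> C" shows "x - y \<in> B"
proof -
  have rad: "x \<in> radical I" "y \<in> radical I" using assms C_rad B_rad by auto
  have "(e 0 - e 1 + x) - 1 *\<^sub>R (2 *\<^sub>R e 0 + y) \<in> R"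
    by (rule reflect_coeff)
      (use assms rad in \<open>simp_all add: axis_root pair_root form_simps rad_simps e_norm e_orth\<close>)
  also have "(e 0 - e 1 + x) - 1 *\<^sub>R (2 *\<^sub>R e 0 + y) = - e 0 - e 1 + (x - y)"
    by (simp add: algebra_simps scaleR_2)
  finally show ?thesis using assms(1) rad by (subst (asm) pair_root) (simp_all add: rad_simps)
qed

end

section \<open>Lattices in the radical\<close>

text \<open>In a diagonalizing basis I(x,x) is the sum of the squares of the first l coordinates;
  the last two basis vectors span the radical.\<close>

lemma signature_semidefinite:
  fixes I :: "'a::euclidean_space \<Rightarrow> 'a \<Rightarrow> real"
  assumes I: "sym_bilinear_form I" and sig: "has_signature I l 2 0"
  shows "semidefinite_form I" and "dim (radical I) = 2"
proof -
  have bl: "bilinear I" and sy: "I x y = I y x" for x y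
    using I by (auto simp: sym_bilinear_form_def)
  have lin: "linear (I x)" "linear (\<lambda>x. I x y)" for x y using bl by (auto simp: bilinear_def)
  obtain B :: "'a list" where len: "length B = l + 2" and dist: "distinct B"
    and ind: "independent (set B)" and sp: "span (set B) = UNIV"
    and orth: "\<And>i j. i < l + 2 \<Longrightarrow> j < l + 2 \<Longrightarrow> i \<noteq> j \<Longrightarrow> I (B!i) (B!j) = 0"
    and norm: "\<And>i. i < l + 2 \<Longrightarrow> I (B!i) (B!i) = (if i < l then 1 else 0)"
    using sig unfolding has_signature_def by auto
  have coord: "\<exists>u. x = (\<Sum>i<l+2. u i *\<^sub>R B!i)" for x
  proof -
    have "x \<in> span (set B)" using sp by simp
    then obtain u where "x = (\<Sum>v\<in>set B. u v *\<^sub>R v)" using span_finite[of "set B"] by auto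
    also have "\<dots> = (\<Sum>i<l+2. u (B!i) *\<^sub>R B!i)"
      by (rule sum.reindex_bij_betw[symmetric, OF bij_betw_nth]) (use dist len in auto)
    finally show ?thesis by (rule exI[of _ "\<lambda>i. u (B!i)"])
  qed
  have basis_eval: "I (\<Sum>i<l+2. u i *\<^sub>R B!i) (B!j) = (if j < l then u j else 0)" if j: "j < l + 2" for u j
  proof -
    have "I (\<Sum>i<l+2. u i *\<^sub>R B!i) (B!j) = (\<Sum>i<l+2. u i * I (B!i) (B!j))"
      using linear_sum[OF lin(2)[of "B!j"], of "\<lambda>i. u i *\<^sub>R B!i" "{..<l+2}"]
      by (simp only: bilinear_lmul[OF bl] real_scaleR_def)
    also have "\<dots> = (\<Sum>i<l+2. if i = j then (if j < l then u j else 0) else 0)"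
      by (rule sum.cong) (use orth norm j in auto)
    finally show ?thesis using j by simp
  qed
  have eval: "I x (\<Sum>i<l+2. w i *\<^sub>R B!i) = (\<Sum>i<l+2. w i * I x (B!i))" for x w
    using linear_sum[OF lin(1)[of x], of "\<lambda>i. w i *\<^sub>R B!i" "{..<l+2}"]
    by (simp only: bilinear_rmul[OF bl] real_scaleR_def)
  have nn: "I x x \<ge> 0 \<and> (I x x = 0 \<longrightarrow> x \<in> radical I)" for x
  proof -
    obtain u where u: "x = (\<Sum>i<l+2. u i *\<^sub>R B!i)" using coord by blast
    have ev: "I x (B!i) = (if i < l then u i else 0)" if "i < l + 2" for i
      using basis_eval[OF that] u by simp
    have sq: "I x x = (\<Sum>i<l+2. u i * I x (B!i))" using eval[of x u] u by simp
    also have "\<dots> = (\<Sum>i<l+2. if i < l then (u i)\<^sup>2 else 0)"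
      by (rule sum.cong) (auto simp: ev power2_eq_square)
    finally have sq: "I x x = (\<Sum>i<l+2. if i < l then (u i)\<^sup>2 else 0)" .
    have "x \<in> radical I" if "I x x = 0"
    proof -
      have z: "\<forall>i\<in>{..<l+2}. (if i < l then (u i)\<^sup>2 else 0) = 0"
        using that unfolding sq by (subst (asm) sum_nonneg_eq_0_iff) auto
      have "I x (B!i) = 0" if "i < l + 2" for i
        using z that ev[OF that] by (auto split: if_splits)
      then have "I x y = 0" for y using coord[of y] eval by auto
      then show ?thesis by (simp add: radical_def)
    qed
    moreover have "I x x \<ge> 0" unfolding sq by (rule sum_nonneg) auto
    ultimately show ?thesis by blast
  qed
  then show "semidefinite_form I" by unfold_locales (use bl sy in auto)
  then interpret semidefinite_form I .
  have rad: "radical I = span {B!l, B!(l+1)}"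
  proof
    have "I (B!j) y = 0" if j: "j \<in> {l, l+1}" for j y
      using coord[of y] basis_eval[of j] j sy[of "B!j" y] by auto
    then have "{B!l, B!(l+1)} \<subseteq> radical I" by (auto simp: radical_def)
    then show "span {B!l, B!(l+1)} \<subseteq> radical I" using subspace_radical span_minimal by blast
    show "radical I \<subseteq> span {B!l, B!(l+1)}"
    proof
      fix x assume x: "x \<in> radical I"
      obtain u where u: "x = (\<Sum>i<l+2. u i *\<^sub>R B!i)" using coord by blast
      have "u i = 0" if "i < l" for i
        using basis_eval[of i u] that radical_left[OF x] u by simp
      then have "x = u l *\<^sub>R B!l + u (l+1) *\<^sub>R B!(l+1)" unfolding u by simp
      then show "x \<in> span {B!l, B!(l+1)}"
        by (simp add: span_add span_mul span_base)
    qed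
  qed
  have "B!l \<noteq> B!(l+1)" using dist len nth_eq_iff_index_eq[of B l "l+1"] by simp
  moreover have "independent {B!l, B!(l+1)}"
    by (rule independent_mono[OF ind]) (use len in auto)
  ultimately show "dim (radical I) = 2"
    using dim_eq_card_independent[of "{B!l, B!(l+1)}"] by (simp add: rad)
qed

section \<open>Integer spans and bases of rank two lattices\<close>

lemma zspan_induct [consumes 1, case_names zero add diff]:
  assumes x: "x \<in> zspan S" and P0: "P 0"
    and add: "\<And>y s. P y \<Longrightarrow> s \<in> S \<Longrightarrow> P (y + s)"
    and diff: "\<And>y s. P y \<Longrightarrow> s \<in> S \<Longrightarrow> P (y - s)"
  shows "P x"
proof -
  have scale: "P (y + real_of_int k *\<^sub>R s)" if "P y" "s \<in> S" for y s k
  proof (induction k rule: int_induct[of _ 0])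
    case (step1 i)
    then show ?case using add[OF step1(2) \<open>s \<in> S\<close>] by (simp add: algebra_simps)
  next
    case (step2 i)
    then show ?case using diff[OF step2(2) \<open>s \<in> S\<close>] by (simp add: algebra_simps)
  qed (use that in simp)
  obtain T c where T: "finite T" "T \<subseteq> S" and x: "x = (\<Sum>v\<in>T. real_of_int (c v) *\<^sub>R v)"
    using x unfolding zspan_def by blast
  show ?thesis unfolding x using T
  proof (induction T)
    case (insert v T)
    then show ?case using scale[of "\<Sum>v\<in>T. real_of_int (c v) *\<^sub>R v" v "c v"] by (simp add: add.commute)
  qed (use P0 in simp)
qed

lemma zspan_0: "0 \<in> zspan S"
  unfolding zspan_def by (intro CollectI exI[of _ "{}"]) simp

lemma zspan_base: "s \<in> S \<Longrightarrow> s \<in> zspan S"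
  unfolding zspan_def by (intro CollectI exI[of _ "{s}"] exI[of _ "\<lambda>_. 1"]) simp

lemma zspan_lin:
  assumes "x \<in> zspan S" "y \<in> zspan S"
  shows "real_of_int j *\<^sub>R x + real_of_int k *\<^sub>R y \<in> zspan S"
proof -
  obtain T c where T: "finite T" "T \<subseteq> S" and x: "x = (\<Sum>v\<in>T. real_of_int (c v) *\<^sub>R v)"
    using assms(1) unfolding zspan_def by blast
  obtain U d where U: "finite U" "U \<subseteq> S" and y: "y = (\<Sum>v\<in>U. real_of_int (d v) *\<^sub>R v)"
    using assms(2) unfolding zspan_def by blast
  have ext: "(\<Sum>v\<in>V. real_of_int (c v) *\<^sub>R v) =
      (\<Sum>v\<in>T \<union> U. real_of_int (if v \<in> V then c v else 0) *\<^sub>R v)" if "V = T \<or> V = U" for V c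
    by (rule sum.mono_neutral_cong_left) (use T U that in auto)
  have "real_of_int j *\<^sub>R x + real_of_int k *\<^sub>R y = (\<Sum>v\<in>T \<union> U. real_of_int
      (j * (if v \<in> T then c v else 0) + k * (if v \<in> U then d v else 0)) *\<^sub>R v)"
    unfolding x y ext[of T c, simplified] ext[of U d, simplified]
    by (simp add: scaleR_sum_right sum.distrib[symmetric] scaleR_add_left)
  then show ?thesis unfolding zspan_def using T U
    by (intro CollectI exI[of _ "T \<union> U"] exI[of _ "\<lambda>v. j * (if v \<in> T then c v else 0) +
      k * (if v \<in> U then d v else 0)"]) simp
qed

lemma zspan_add: "x \<in> zspan S \<Longrightarrow> y \<in> zspan S \<Longrightarrow> x + y \<in> zspan S"
  using zspan_lin[of x S y 1 1] by simp

lemma zspan_diff: "x \<in> zspan S \<Longrightarrow> y \<in> zspan S \<Longrightarrow> x - y \<in> zspan S"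
  using zspan_lin[of x S y 1 "-1"] by simp

lemma zspan_scale: "x \<in> zspan S \<Longrightarrow> real_of_int k *\<^sub>R x \<in> zspan S"
  using zspan_lin[of x S x k 0] by simp

lemma zspan_subset_span: "zspan S \<subseteq> span S"
proof
  fix x assume "x \<in> zspan S"
  then show "x \<in> span S"
    by (induction rule: zspan_induct) (auto intro: span_add span_diff span_base span_zero)
qed

lemma full_lattice_span:
  assumes "full_lattice_in (zspan R) UNIV"
  shows "span R = UNIV"
proof -
  obtain D where D: "span D = UNIV" "zspan R = zspan D"
    using assms unfolding full_lattice_in_def by auto
  have "D \<subseteq> span R" using zspan_base zspan_subset_span D by blast
  then show ?thesis using D(1) span_minimal[OF _ subspace_span, of D R] by auto
qed

text \<open>The coordinates with respect to \<open>D\<close> extend to linear functionals, which are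
  bounded by a multiple of the norm; integer coordinates of bounded size are finite in
  number.\<close>

lemma zspan_bounded_finite:
  fixes D :: "'a::euclidean_space set"
  assumes D: "independent D"
  shows "finite {x \<in> zspan D. norm x \<le> K}"
proof -
  have fin: "finite D" using independent_bound[OF D] by blast
  have "\<exists>h. linear h \<and> (\<forall>w\<in>D. h w = (if w = v then 1 else 0 :: real))" for v
    using linear_independent_extend[OF D, of "\<lambda>w. if w = v then 1 else 0"] by simp
  then obtain h where h: "\<And>v. linear (h v)" and hD: "\<And>v w. w \<in> D \<Longrightarrow> h v w = (if w = v then 1 else 0 :: real)"
    by metis
  have "\<exists>M. \<forall>x. \<bar>h v x\<bar> \<le> M * norm x" for v
    using linear_bounded[OF h[of v]] by simp
  then obtain M where M: "\<And>v x. \<bar>h v x\<bar> \<le> M v * norm x" by metis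
  define N where "N v = \<lceil>\<bar>M v\<bar> * \<bar>K\<bar>\<rceil>" for v
  have "{x \<in> zspan D. norm x \<le> K} \<subseteq>
    (\<lambda>c. \<Sum>v\<in>D. real_of_int (c v) *\<^sub>R v) ` (\<Pi>\<^sub>E v\<in>D. {- N v..N v})"
  proof clarify
    fix x assume x: "x \<in> zspan D" and n: "norm x \<le> K"
    obtain T c where T: "finite T" "T \<subseteq> D" and xs: "x = (\<Sum>v\<in>T. real_of_int (c v) *\<^sub>R v)"
      using x unfolding zspan_def by blast
    define c' where "c' = restrict (\<lambda>v. if v \<in> T then c v else 0) D"
    have xc: "x = (\<Sum>v\<in>D. real_of_int (c' v) *\<^sub>R v)"
      unfolding xs by (rule sum.mono_neutral_cong_left) (use fin T in \<open>auto simp: c'_def\<close>)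
    have "c' v \<in> {- N v..N v}" if v: "v \<in> D" for v
    proof -
      have "h v x = (\<Sum>w\<in>D. real_of_int (c' w) * h v w)"
        unfolding xc using h by (simp add: linear_sum linear_scale)
      also have "\<dots> = (\<Sum>w\<in>D. if w = v then real_of_int (c' v) else 0)"
        by (rule sum.cong) (auto simp: hD)
      finally have "\<bar>real_of_int (c' v)\<bar> \<le> M v * norm x" using M[of v x] v fin by simp
      also have "\<dots> \<le> \<bar>M v\<bar> * \<bar>K\<bar>" using n by (intro mult_mono) auto
      finally show ?thesis unfolding N_def by (simp add: abs_le_iff) linarith
    qed
    then have "c' \<in> (\<Pi>\<^sub>E v\<in>D. {- N v..N v})" unfolding c'_def by auto
    then show "x \<in> (\<lambda>c. \<Sum>v\<in>D. real_of_int (c v) *\<^sub>R v) ` (\<Pi>\<^sub>E v\<in>D. {- N v..N v})"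
      using xc by blast
  qed
  moreover have "finite (\<Pi>\<^sub>E v\<in>D. {- N v..N v})" using fin by (intro finite_PiE) auto
  ultimately show ?thesis by (meson finite_imageI finite_subset)
qed

text \<open>Completes the primitive vector \<open>a\<close> by a lattice vector of least positive
  height above the line Ra, the height being the functional \<open>g\<close>; division with
  remainder does the rest.\<close>

lemma rank_two_basis:
  fixes L :: "'a::euclidean_space set"
  assumes diff: "\<And>x y. x \<in> L \<Longrightarrow> y \<in> L \<Longrightarrow> x - y \<in> L"
    and scale: "\<And>x k. x \<in> L \<Longrightarrow> real_of_int k *\<^sub>R x \<in> L"
    and fin: "\<And>K. finite {x \<in> L. norm x \<le> K}"
    and a: "a \<in> L" and w: "w \<in> L" and ind: "independent {a, w}" "a \<noteq> w"
    and span: "L \<subseteq> span {a, w}"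
    and prim: "\<And>c. c *\<^sub>R a \<in> L \<Longrightarrow> \<exists>m. c *\<^sub>R a = real_of_int m *\<^sub>R a"
  obtains b where "b \<in> L" "\<And>x. x \<in> L \<Longrightarrow> \<exists>m n. x = real_of_int m *\<^sub>R a + real_of_int n *\<^sub>R b"
proof -
  obtain g :: "'a \<Rightarrow> real" where g: "linear g" and ga: "g a = 0" and gw: "g w = 1"
    using linear_independent_extend[OF ind(1), of "\<lambda>x. if x = w then 1 else 0"] ind(2) by auto
  have coord: "\<exists>c. x = c *\<^sub>R a + g x *\<^sub>R w" if "x \<in> L" for x
  proof -
    have "x \<in> span {a, w}" using span that by blast
    then obtain c k where "x - c *\<^sub>R a = k *\<^sub>R w" by (auto simp: span_insert span_singleton)
    then have x: "x = c *\<^sub>R a + k *\<^sub>R w" by (simp add: algebra_simps)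
    moreover have "g x = k" unfolding x using g ga gw by (simp add: linear_add linear_scale)
    ultimately show ?thesis by (intro exI[of _ c]) simp
  qed
  \<comment> \<open>Integer multiples of \<open>a\<close> bring the a-coordinate into [0,1), so the
    height can be minimized over this bounded, hence finite set. It contains \<open>w\<close>, of
    height 1.\<close>
  define W where "W = {x \<in> L. \<exists>c. x = c *\<^sub>R a + g x *\<^sub>R w \<and> 0 \<le> c \<and> c < 1 \<and> 0 < g x \<and> g x \<le> 1}"
  have "W \<subseteq> {x \<in> L. norm x \<le> norm a + norm w}"
  proof
    fix x assume x: "x \<in> W"
    then obtain c where c: "x = c *\<^sub>R a + g x *\<^sub>R w" "0 \<le> c" "c < 1" "0 < g x" "g x \<le> 1"
      unfolding W_def by blast
    have "norm x \<le> norm (c *\<^sub>R a) + norm (g x *\<^sub>R w)" by (subst c(1)) (rule norm_triangle_ineq)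
    also have "\<dots> \<le> 1 * norm a + 1 * norm w"
      unfolding norm_scaleR by (intro add_mono mult_right_mono) (use c in auto)
    finally show "x \<in> {x \<in> L. norm x \<le> norm a + norm w}" using x by (simp add: W_def)
  qed
  then have finW: "finite W" using fin finite_subset by blast
  have "w \<in> W" using w gw by (auto simp: W_def intro!: exI[of _ 0])
  then obtain b where b: "b \<in> W" and min: "\<And>x. x \<in> W \<Longrightarrow> g b \<le> g x"
    using finW arg_min_if_finite(1)[of W g] arg_min_least[of W _ g] by blast
  have bL: "b \<in> L" and gb: "0 < g b" "g b \<le> 1" using b by (auto simp: W_def)
  have "\<exists>m n. x = real_of_int m *\<^sub>R a + real_of_int n *\<^sub>R b" if x: "x \<in> L" for x
  proof -
    define n where "n = \<lfloor>g x / g b\<rfloor>"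
    define y where "y = x - real_of_int n *\<^sub>R b"
    have yL: "y \<in> L" unfolding y_def using diff[OF x scale[OF bL]] .
    have gy: "g y = g x - n * g b" unfolding y_def using g by (simp add: linear_diff linear_scale)
    have "real_of_int n \<le> g x / g b" "g x / g b < real_of_int n + 1" unfolding n_def by linarith+
    then have gy01: "0 \<le> g y" "g y < g b" unfolding gy using gb by (simp_all add: field_simps)
    obtain c where c: "y = c *\<^sub>R a + g y *\<^sub>R w" using coord[OF yL] by blast
    define z where "z = y - real_of_int \<lfloor>c\<rfloor> *\<^sub>R a"
    have zL: "z \<in> L" unfolding z_def using diff[OF yL scale[OF a]] .
    have gz: "g z = g y" unfolding z_def using g ga by (simp add: linear_diff linear_scale)
    have "z = frac c *\<^sub>R a + t *\<^sub>R w" if "y = c *\<^sub>R a + t *\<^sub>R w" for t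
      unfolding z_def frac_def that by (simp add: algebra_simps)
    then have z: "z = frac c *\<^sub>R a + g z *\<^sub>R w" unfolding gz using c by blast
    \<comment> \<open>A positive remainder, reduced modulo \<open>a\<close> to \<open>z\<close>,
      would be an element of \<open>W\<close> lower than \<open>b\<close>.\<close>
    have "g y = 0"
    proof (rule ccontr)
      assume "g y \<noteq> 0"
      then have "z \<in> W" unfolding W_def using zL z gz gy01 gb frac_ge_0 frac_lt_1 by fastforce
      from min[OF this] show False using gz gy01 by simp
    qed
    then have "y = c *\<^sub>R a" using c by simp
    then obtain m where "y = real_of_int m *\<^sub>R a" using prim yL by metis
    then show ?thesis by (auto simp: y_def algebra_simps)
  qed
  then show thesis using that bL by blast
qed

section \<open>Constraints on the fibres\<close>

text \<open>The map from the model into F is an explicit linear combination, so isomorphisms are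
  built in that direction and inverted here.\<close>

lemma iso_to_modelI:
  fixes emb :: "(nat \<Rightarrow> real) \<Rightarrow> 'a::real_vector"
  assumes add: "\<And>u v. emb (\<lambda>i. u i + v i) = emb u + emb v"
    and scale: "\<And>c v. emb (\<lambda>i. c * v i) = c *\<^sub>R emb v"
    and bij: "bij_betw emb (model_space l) UNIV"
    and R: "R = emb ` R'" "R' \<subseteq> model_space l" and G: "G = emb ` model_G l"
  shows "iso_to_model l R G R'"
proof -
  let ?\<phi> = "the_inv_into (model_space l) emb"
  have inj: "inj_on emb (model_space l)" using bij by (simp add: bij_betw_def)
  have \<phi>: "?\<phi> (emb v) = v" if "v \<in> model_space l" for v using the_inv_into_f_f[OF inj that] .
  have surj: "\<exists>v\<in>model_space l. x = emb v" for x using bij by (auto simp: bij_betw_def)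
  show ?thesis unfolding iso_to_model_def
  proof (intro exI[of _ ?\<phi>] conjI allI)
    fix x y
    obtain u v where u: "u \<in> model_space l" "x = emb u" and v: "v \<in> model_space l" "y = emb v"
      using surj by meson
    have "(\<lambda>i. u i + v i) \<in> model_space l" using u v by (simp add: model_space_def)
    from \<phi>[OF this] show "?\<phi> (x + y) = (\<lambda>i. ?\<phi> x i + ?\<phi> y i)"
      using u v \<phi> by (simp add: add)
  next
    fix c x
    obtain u where u: "u \<in> model_space l" "x = emb u" using surj by meson
    have "(\<lambda>i. c * u i) \<in> model_space l" using u by (simp add: model_space_def)
    from \<phi>[OF this] show "?\<phi> (c *\<^sub>R x) = (\<lambda>i. c * ?\<phi> x i)"
      using u \<phi> by (simp add: scale)
  next
    show "bij_betw ?\<phi> UNIV (model_space l)" using bij_betw_the_inv_into[OF bij] .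
    have sub: "?\<phi> ` emb ` X = X" if "X \<subseteq> model_space l" for X
      using that \<phi> by (force simp: image_image)
    show "?\<phi> ` R = R'" unfolding R(1) using sub[OF R(2)] .
    have "model_G l \<subseteq> model_space l" by (auto simp: model_G_def model_space_def)
    then show "?\<phi> ` G = model_G l" unfolding G using sub by blast
  qed
qed

text \<open>The constraints on the fibres of the projection onto the finite root system, in
  coordinates with respect to a basis of the radical lattice. The three parity conditions say
  that \<open>A\<close> generates this lattice modulo 2.\<close>
locale admissible =
  fixes l :: nat and A B C :: "(int \<times> int) set"
  assumes zero: "(0, 0) \<in> A" "(0, 0) \<in> B" "(0, 0) \<in> C"
    and A_period: "(m, n) \<in> A \<Longrightarrow> (m + 2 * p, n + 2 * q) \<in> A"
    and B_period: "(m, n) \<in> B \<Longrightarrow> (m + 2 * p, n + 2 * q) \<in> B"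
    and A_add_B: "(m, n) \<in> A \<Longrightarrow> (p, q) \<in> B \<Longrightarrow> (m + p, n + q) \<in> A"
    and B_add_C: "(m, n) \<in> B \<Longrightarrow> (p, q) \<in> C \<Longrightarrow> (m + p, n + q) \<in> B"
    and C_add_B: "(m, n) \<in> C \<Longrightarrow> (p, q) \<in> B \<Longrightarrow> (m + 2 * p, n + 2 * q) \<in> C"
    and B_add_B: "l \<noteq> 2 \<Longrightarrow> (m, n) \<in> B \<Longrightarrow> (p, q) \<in> B \<Longrightarrow> (m + p, n + q) \<in> B"
    and generating: "\<exists>(m, n)\<in>A. odd m" "\<exists>(m, n)\<in>A. odd n" "\<exists>(m, n)\<in>A. odd (m + n)"

section \<open>The radical lattice and its translations of the fibres\<close>

context framed_roots
begin

lemma A_minus: assumes "x \<in> A" shows "- x \<in> A"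
proof -
  have "x - 2 *\<^sub>R x = - x" by (simp add: scaleR_2)
  then show ?thesis using A_A[OF assms assms] by (simp only:)
qed

lemma C_minus: assumes "x \<in> C" shows "- x \<in> C"
proof -
  have "x - 2 *\<^sub>R x = - x" by (simp add: scaleR_2)
  then show ?thesis using C_C[OF assms assms] by (simp only:)
qed

lemma A_add_C: "x \<in> A \<Longrightarrow> y \<in> C \<Longrightarrow> x + y \<in> A"
  using A_C[of x "- y"] C_minus by simp

lemma C_subset_A: "C \<subseteq> A"
  using A_add_C[of 0] zero_mem by auto

lemma B_subset_A: "l \<ge> 2 \<Longrightarrow> B \<subseteq> A"
  using A_B[of 0] zero_mem by auto

definition lat where "lat = zspan A"

lemma lat_rad: "lat \<subseteq> radical I"
  unfolding lat_def by (rule order_trans[OF zspan_subset_span span_minimal[OF A_rad subspace_radical]])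

lemma A_lat: "A \<subseteq> lat"
  unfolding lat_def by (rule subsetI) (rule zspan_base)

text \<open>Each generator s of the lattice lies in \<open>A\<close>, so \<open>A_A\<close> and the
  symmetry of \<open>A\<close> allow translation by 2s and -2s. Long roots obtain only the period 4
  this way, because their Cartan integer with short roots is 4.\<close>

lemma A_period: "x \<in> lat \<Longrightarrow> y \<in> A \<Longrightarrow> y + 2 *\<^sub>R x \<in> A"
  unfolding lat_def
proof (induction x arbitrary: y rule: zspan_induct)
  case (add x s)
  have "y + 2 *\<^sub>R x - 2 *\<^sub>R (- s) \<in> A"
    by (intro A_A A_minus add)
  then show ?case by (simp add: algebra_simps)
next
  case (diff x s)
  have "y + 2 *\<^sub>R x - 2 *\<^sub>R s \<in> A"
    by (intro A_A diff)
  then show ?case by (simp add: algebra_simps)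
qed simp

lemma B_period: "x \<in> lat \<Longrightarrow> l \<ge> 2 \<Longrightarrow> y \<in> B \<Longrightarrow> y + 2 *\<^sub>R x \<in> B"
  unfolding lat_def
proof (induction x arbitrary: y rule: zspan_induct)
  case (add x s)
  have "y + 2 *\<^sub>R x - 2 *\<^sub>R (- s) \<in> B"
    by (intro B_A A_minus add)
  then show ?case by (simp add: algebra_simps)
next
  case (diff x s)
  have "y + 2 *\<^sub>R x - 2 *\<^sub>R s \<in> B"
    by (intro B_A diff)
  then show ?case by (simp add: algebra_simps)
qed simp

lemma C_period: "x \<in> lat \<Longrightarrow> y \<in> C \<Longrightarrow> y + 4 *\<^sub>R x \<in> C"
  unfolding lat_def
proof (induction x arbitrary: y rule: zspan_induct)
  case (add x s)
  have "y + 4 *\<^sub>R x - 4 *\<^sub>R (- s) \<in> C"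
    by (intro C_A A_minus add)
  then show ?case by (simp add: algebra_simps)
next
  case (diff x s)
  have "y + 4 *\<^sub>R x - 4 *\<^sub>R s \<in> C"
    by (intro C_A diff)
  then show ?case by (simp add: algebra_simps)
qed simp

text \<open>For \<open>l = 1\<close> there are no middle roots; the joint stabilizer of the other two fibres then
  satisfies all the constraints that the middle fibre satisfies for larger \<open>l\<close>.\<close>
definition M where
  "M = (if l = 1 then {x \<in> lat. (\<forall>y\<in>A. y + x \<in> A \<and> y - x \<in> A) \<and> (\<forall>y\<in>C. y + 2 *\<^sub>R x \<in> C \<and> y - 2 *\<^sub>R x \<in> C)}
        else B)"

lemma M_one:
  "l = 1 \<Longrightarrow> x \<in> M \<longleftrightarrow>
    x \<in> lat \<and> (\<forall>y\<in>A. y + x \<in> A \<and> y - x \<in> A) \<and> (\<forall>y\<in>C. y + 2 *\<^sub>R x \<in> C \<and> y - 2 *\<^sub>R x \<in> C)"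
  unfolding M_def by (subst if_P) auto

lemma M_large: "l \<ge> 2 \<Longrightarrow> M = B"
  by (auto simp: M_def)

lemma l_cases: obtains "l = 1" | "l \<ge> 2"
  using l by linarith

lemma lat_0: "0 \<in> lat"
  unfolding lat_def by (rule zspan_0)

lemma lat_add: "x \<in> lat \<Longrightarrow> y \<in> lat \<Longrightarrow> x + y \<in> lat"
  unfolding lat_def by (rule zspan_add)

lemma lat_diff: "x \<in> lat \<Longrightarrow> y \<in> lat \<Longrightarrow> x - y \<in> lat"
  unfolding lat_def by (rule zspan_diff)

lemma lat_minus: "x \<in> lat \<Longrightarrow> - x \<in> lat"
  using lat_diff[OF lat_0] by simp

lemma zero_M: "0 \<in> M"
proof (rule l_cases)
  assume l: "l = 1"
  show ?thesis unfolding M_one[OF l] by (simp add: lat_0)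
qed (simp add: M_large zero_mem)

lemma M_period:
  assumes x: "x \<in> lat" and y: "y \<in> M"
  shows "y + 2 *\<^sub>R x \<in> M"
proof (rule l_cases)
  assume l: "l = 1"
  note y = y[unfolded M_one[OF l]]
  show ?thesis unfolding M_one[OF l]
  proof (intro conjI ballI)
    show "y + 2 *\<^sub>R x \<in> lat" using y x by (simp add: lat_add scaleR_2)
    fix z assume "z \<in> A"
    then show "z + (y + 2 *\<^sub>R x) \<in> A" "z - (y + 2 *\<^sub>R x) \<in> A"
      using A_period[OF x, of "z + y"] A_period[OF lat_minus[OF x], of "z - y"] y
      by (simp_all add: add.assoc diff_diff_eq)
  next
    fix z assume "z \<in> C"
    then have "z + 2 *\<^sub>R y + 4 *\<^sub>R x \<in> C" "z - 2 *\<^sub>R y + 4 *\<^sub>R (- x) \<in> C"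
      using C_period[OF x, of "z + 2 *\<^sub>R y"] C_period[OF lat_minus[OF x], of "z - 2 *\<^sub>R y"] y
      by blast+
    then show "z + 2 *\<^sub>R (y + 2 *\<^sub>R x) \<in> C" "z - 2 *\<^sub>R (y + 2 *\<^sub>R x) \<in> C"
      by (simp_all add: add.assoc diff_diff_eq scaleR_add_right)
  qed
qed (use assms B_period M_large in simp)

lemma A_M: "x \<in> A \<Longrightarrow> y \<in> M \<Longrightarrow> x + y \<in> A"
  by (rule l_cases) (use A_B M_one M_large in simp_all)

lemma C_M: "x \<in> C \<Longrightarrow> y \<in> M \<Longrightarrow> x + 2 *\<^sub>R y \<in> C"
  by (rule l_cases) (use C_B M_one M_large in simp_all)

lemma M_add: assumes "l \<noteq> 2" and x: "x \<in> M" and y: "y \<in> M" shows "x + y \<in> M"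
proof (cases "l = 1")
  case l: True
  note x = x[unfolded M_one[OF l]] and y = y[unfolded M_one[OF l]]
  show ?thesis unfolding M_one[OF l]
  proof (intro conjI ballI)
    show "x + y \<in> lat" using x y lat_add by blast
    fix z assume "z \<in> A"
    then have "z + x + y \<in> A" "z - x - y \<in> A" using x y by auto
    then show "z + (x + y) \<in> A" "z - (x + y) \<in> A" by (simp_all add: algebra_simps)
  next
    fix z assume "z \<in> C"
    then have "z + 2 *\<^sub>R x + 2 *\<^sub>R y \<in> C" "z - 2 *\<^sub>R x - 2 *\<^sub>R y \<in> C" using x y by auto
    then show "z + 2 *\<^sub>R (x + y) \<in> C" "z - 2 *\<^sub>R (x + y) \<in> C" by (simp_all add: algebra_simps)
  qed
qed (use assms B_add l M_large in simp)

text \<open>This keeps the rule B + C = B alive for l = 1: long translations preserve the short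
  fibre, and their doubles preserve the long one.\<close>

lemma C_in_M:
  assumes l: "l = 1" and x: "x \<in> C"
  shows "x \<in> M"
  unfolding M_one[OF l]
proof (intro conjI ballI)
  show "x \<in> lat" using x C_subset_A A_lat by blast
  fix y
  show "y + x \<in> A" "y - x \<in> A" if "y \<in> A" using that x A_add_C A_C by auto
  show "y + 2 *\<^sub>R x \<in> C" "y - 2 *\<^sub>R x \<in> C" if "y \<in> C"
    using C_C[OF that C_minus[OF x]] C_C[OF that x] by simp_all
qed

lemma M_C: assumes "x \<in> M" "y \<in> C" shows "x + y \<in> M"
proof (cases "l = 1")
  case True
  then show ?thesis using M_add[of x y] C_in_M assms by simp
next
  case False
  then show ?thesis using B_C[of x "- y"] C_minus assms l by (simp add: M_def)
qed

lemma root_lat: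
  assumes "s \<in> R"
  obtains v d where "v \<in> BCs l \<union> BCm l \<union> BCl l" "d \<in> lat" "s = (\<Sum>i<l. v i *\<^sub>R e i) + d"
proof -
  obtain v d where v: "v \<in> BCs l \<union> BCm l \<union> BCl l" and d: "d \<in> radical I"
    and s: "s = (\<Sum>i<l. v i *\<^sub>R e i) + d" using root_shape[OF assms] by blast
  have l2: "l \<ge> 2" if "v \<in> BCm l" using that by (auto simp: BCm_def)
  from v consider "d \<in> A" | "l \<ge> 2" "d \<in> B" | "d \<in> C"
    using sum_mem_iff[OF d, of v] assms l2 unfolding s by blast
  then have "d \<in> lat"
    by cases (use A_lat B_subset_A C_subset_A in blast)+
  then show thesis using that v s by blast
qed

lemma coefficient:
  assumes i: "i < l" and d: "d \<in> radical I"
  shows "I ((\<Sum>i<l. n i *\<^sub>R e i) + d) (e i) = n i * q"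
proof -
  have "I (\<Sum>i<l. n i *\<^sub>R e i) (e i) = n i * I (e i) (e i)"
    by (rule orthogonal_sum) (use i e_orth in auto)
  then show ?thesis using e_norm[OF i] radical_left[OF d] by (simp add: form_simps)
qed

text \<open>All fibres lie in \<open>A\<close>, so the radical part of any integer combination of
  roots lies in \<open>lat\<close>; pairing a radical vector with \<open>e i\<close> kills its frame
  coefficients. Conversely y = (e_0 + y) - e_0 for y in \<open>A\<close>.\<close>

lemma lat_characterization:
  assumes "x \<in> radical I"
  shows "x \<in> zspan R \<longleftrightarrow> x \<in> lat"
proof
  have A_R: "y \<in> zspan R" if "y \<in> A" for y
  proof -
    have "e 0 + y \<in> zspan R" "e 0 \<in> zspan R" using that e_root l by (auto simp: A_def intro: zspan_base)
    from zspan_diff[OF this] show ?thesis by simp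
  qed
  show "x \<in> zspan R" if "x \<in> lat"
    using that unfolding lat_def
    by (induction rule: zspan_induct) (auto intro: zspan_0 zspan_add zspan_diff A_R)
  assume "x \<in> zspan R"
  then have "\<exists>n d. d \<in> lat \<and> x = (\<Sum>i<l. n i *\<^sub>R e i) + d"
  proof (induction rule: zspan_induct)
    case zero
    show ?case using lat_0 by (intro exI[of _ "\<lambda>_. 0"] exI[of _ 0]) simp
  next
    case (add y s)
    obtain n d where nd: "d \<in> lat" "y = (\<Sum>i<l. n i *\<^sub>R e i) + d" using add by blast
    obtain v d' where d': "d' \<in> lat" and s: "s = (\<Sum>i<l. v i *\<^sub>R e i) + d'" using root_lat add by blast
    have "y + s = (\<Sum>i<l. (n i + v i) *\<^sub>R e i) + (d + d')"
      unfolding nd s by (simp add: scaleR_add_left sum.distrib)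
    then show ?case using lat_add[OF nd(1) d'] by (intro exI[of _ "\<lambda>i. n i + v i"] exI[of _ "d + d'"]) simp
  next
    case (diff y s)
    obtain n d where nd: "d \<in> lat" "y = (\<Sum>i<l. n i *\<^sub>R e i) + d" using diff by blast
    obtain v d' where d': "d' \<in> lat" and s: "s = (\<Sum>i<l. v i *\<^sub>R e i) + d'" using root_lat diff by blast
    have "y - s = (\<Sum>i<l. (n i - v i) *\<^sub>R e i) + (d - d')"
      unfolding nd s by (simp add: scaleR_diff_left sum_subtractf)
    then show ?case using lat_diff[OF nd(1) d'] by (intro exI[of _ "\<lambda>i. n i - v i"] exI[of _ "d - d'"]) simp
  qed
  then obtain n d where nd: "d \<in> lat" "x = (\<Sum>i<l. n i *\<^sub>R e i) + d" by blast
  have "n i = 0" if i: "i < l" for i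
    using coefficient[OF i, of d n] radical_left[OF assms, of "e i"] nd lat_rad q_pos by auto
  then show "x \<in> lat" using nd by simp
qed

end

section \<open>Coordinates\<close>

lemma zspan_singleton: "x \<in> zspan {a} \<Longrightarrow> \<exists>m. x = real_of_int m *\<^sub>R a"
proof (induction rule: zspan_induct)
  case zero
  show ?case by (intro exI[of _ 0]) simp
next
  case (add y s)
  then obtain m where "y + s = real_of_int (m + 1) *\<^sub>R a" by (auto simp: algebra_simps)
  then show ?case by blast
next
  case (diff y s)
  then obtain m where "y - s = real_of_int (m - 1) *\<^sub>R a" by (auto simp: algebra_simps)
  then show ?case by blast
qed

context framed_roots
begin

lemma span_R_decomp:
  assumes "x \<in> span R"
  shows "\<exists>n d. d \<in> span A \<and> x = (\<Sum>i<l. n i *\<^sub>R e i) + d"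
  using assms
proof (induction rule: span_induct_alt)
  case base
  show ?case by (intro exI[of _ "\<lambda>_. 0"] exI[of _ 0]) (simp add: span_zero)
next
  case (step c s y)
  obtain n d where nd: "d \<in> span A" "y = (\<Sum>i<l. n i *\<^sub>R e i) + d" using step by blast
  obtain v d' where d': "d' \<in> lat" and s: "s = (\<Sum>i<l. v i *\<^sub>R e i) + d'"
    using root_lat step by blast
  have "d' \<in> span A" using d' zspan_subset_span unfolding lat_def by blast
  then have "c *\<^sub>R d' + d \<in> span A" using nd by (simp add: span_add span_mul)
  moreover have "c *\<^sub>R s + y = (\<Sum>i<l. (c * v i + n i) *\<^sub>R e i) + (c *\<^sub>R d' + d)"
    unfolding nd s by (simp add: scaleR_add_left sum.distrib scaleR_add_right scaleR_sum_right)
  ultimately show ?case by (intro exI[of _ "\<lambda>i. c * v i + n i"] exI[of _ "c *\<^sub>R d' + d"]) simp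
qed

lemma radical_span_A:
  assumes full: "span R = UNIV"
  shows "radical I = span A"
proof
  show "span A \<subseteq> radical I" using span_minimal[OF A_rad subspace_radical] .
  show "radical I \<subseteq> span A"
  proof
    fix x assume x: "x \<in> radical I"
    obtain n d where nd: "d \<in> span A" "x = (\<Sum>i<l. n i *\<^sub>R e i) + d"
      using span_R_decomp[of x] full by auto
    have "d \<in> radical I" using nd(1) span_minimal[OF A_rad subspace_radical] by blast
    then have "n i = 0" if i: "i < l" for i
      using coefficient[OF i, of d n] radical_left[OF x, of "e i"] nd q_pos by auto
    then show "x \<in> span A" using nd by simp
  qed
qed

text \<open>The marking provides a generator \<open>a\<close> of the part of the root lattice on G.
  Being a generator there, \<open>a\<close> is primitive in \<open>lat\<close> and extends to a
  basis whose first vector spans G.\<close>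

lemma lattice_basis:
  assumes full: "full_lattice_in (zspan R) UNIV" and mark: "marking I R G"
    and rad2: "dim (radical I) = 2"
  obtains a b where "G = span {a}" "a \<in> lat" "b \<in> lat"
    "\<And>c d. c *\<^sub>R a + d *\<^sub>R b = 0 \<Longrightarrow> c = 0 \<and> d = 0"
    "\<And>x. x \<in> radical I \<Longrightarrow> \<exists>c d. x = c *\<^sub>R a + d *\<^sub>R b"
    "\<And>x. x \<in> lat \<Longrightarrow> \<exists>m n. x = real_of_int m *\<^sub>R a + real_of_int n *\<^sub>R b"
proof -
  have spanR: "span R = UNIV" by (rule full_lattice_span[OF full])
  obtain D where D: "independent D" "zspan R = zspan D"
    using full unfolding full_lattice_in_def by auto
  have G: "dim G = 1" "G \<subseteq> radical I" using mark by (auto simp: marking_def)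
  obtain E where E: "independent E" "span E = G" "G \<inter> zspan R = zspan E"
    using mark unfolding marking_def full_lattice_in_def by auto
  have "card E = 1" using dim_eq_card_independent[OF E(1)] E(2) G(1) by (metis dim_span)
  then obtain a where "E = {a}" using card_1_singletonE by blast
  then have aG: "span {a} = G" and aL: "G \<inter> zspan R = zspan {a}" and a0: "a \<noteq> 0"
    using E by auto
  have a: "a \<in> lat"
    using zspan_base[of a "{a}"] lat_characterization[of a] G(2) unfolding aL[symmetric] by blast
  have "\<not> A \<subseteq> span {a}"
  proof
    assume "A \<subseteq> span {a}"
    then have "span A \<subseteq> span {a}" using span_minimal subspace_span by blast
    then have "dim (radical I) \<le> dim (span {a})" unfolding radical_span_A[OF spanR] by (rule dim_subset)
    then show False using rad2 G(1) aG by simp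
  qed
  then obtain w where w: "w \<in> A" "w \<notin> span {a}" by blast
  have wl: "w \<in> lat" using w A_lat by blast
  have aw: "a \<noteq> w" using w span_base by blast
  have ind: "independent {a, w}"
    using w(2) a0 by (simp add: insert_commute[of a w] independent_insert)
  have "span {a, w} = radical I"
  proof (rule subspace_dim_equal)
    have "{a, w} \<subseteq> radical I" using a wl lat_rad by blast
    then show "span {a, w} \<subseteq> radical I" using span_minimal subspace_radical by blast
    show "dim (radical I) \<le> dim (span {a, w})"
      using rad2 dim_eq_card_independent[OF ind] aw by simp
  qed (simp_all add: subspace_radical)
  then have spanaw: "span {a, w} = radical I" .
  have prim: "\<exists>m. c *\<^sub>R a = real_of_int m *\<^sub>R a" if "c *\<^sub>R a \<in> lat" for c
  proof -
    have "c *\<^sub>R a \<in> G" unfolding aG[symmetric] by (simp add: span_mul span_base)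
    then have "c *\<^sub>R a \<in> G \<inter> zspan R" using that lat_characterization lat_rad by blast
    then show ?thesis unfolding aL by (rule zspan_singleton)
  qed
  have fin: "finite {x \<in> lat. norm x \<le> K}" for K
  proof -
    have "lat \<subseteq> zspan D" using lat_characterization lat_rad D(2) by blast
    then have "{x \<in> lat. norm x \<le> K} \<subseteq> {x \<in> zspan D. norm x \<le> K}" by blast
    then show ?thesis using zspan_bounded_finite[OF D(1)] finite_subset by blast
  qed
  have "lat \<subseteq> span {a, w}" using spanaw lat_rad by simp
  then obtain b where b: "b \<in> lat"
    and ab: "\<And>x. x \<in> lat \<Longrightarrow> \<exists>m n. x = real_of_int m *\<^sub>R a + real_of_int n *\<^sub>R b"
    using rank_two_basis[of lat a w] fin a wl ind aw prim lat_diff zspan_scale[of _ A, folded lat_def]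
    by metis
  obtain m n where wmn: "w = real_of_int m *\<^sub>R a + real_of_int n *\<^sub>R b" using ab[OF wl] by blast
  have "c = 0 \<and> d = 0" if "c *\<^sub>R a + d *\<^sub>R b = 0" for c d
  proof -
    have "d = 0"
    proof (rule ccontr)
      assume "d \<noteq> 0"
      have "d *\<^sub>R b = - (c *\<^sub>R a)" using that by (simp add: eq_neg_iff_add_eq_0 add.commute)
      then have "(1 / d) *\<^sub>R (d *\<^sub>R b) = (1 / d) *\<^sub>R (- (c *\<^sub>R a))" by simp
      then have "b = (- c / d) *\<^sub>R a" using \<open>d \<noteq> 0\<close> by simp
      then have "w \<in> span {a}" unfolding wmn by (simp add: span_add span_diff span_mul span_base)
      then show False using w by simp
    qed
    then show ?thesis using that a0 by simp
  qed
  moreover have "\<exists>c d. x = c *\<^sub>R a + d *\<^sub>R b" if "x \<in> radical I" for x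
  proof -
    have "x \<in> span {a, b}"
    proof -
      have "w \<in> span {a, b}" unfolding wmn by (simp add: span_add span_mul span_base)
      then have "{a, w} \<subseteq> span {a, b}" by (simp add: span_base)
      then have "span {a, w} \<subseteq> span {a, b}" using span_minimal subspace_span by blast
      then show ?thesis using that spanaw by blast
    qed
    then obtain c d where "x - c *\<^sub>R a = d *\<^sub>R b" by (auto simp: span_insert span_singleton)
    then have "x = c *\<^sub>R a + d *\<^sub>R b" by (simp add: algebra_simps)
    then show ?thesis by blast
  qed
  ultimately show thesis using that aG a b ab by metis
qed

lemma coordinates:
  assumes full: "full_lattice_in (zspan R) UNIV" and mark: "marking I R G"
    and rad2: "dim (radical I) = 2"
  obtains A' B' C' where "admissible l A' B' C'" "iso_to_model l R G (mroots l A' B' C')"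
proof -
  obtain a b where G: "G = span {a}" and aL: "a \<in> lat" and bL: "b \<in> lat"
    and ind: "\<And>c d. c *\<^sub>R a + d *\<^sub>R b = 0 \<Longrightarrow> c = 0 \<and> d = 0"
    and rad: "\<And>x. x \<in> radical I \<Longrightarrow> \<exists>c d. x = c *\<^sub>R a + d *\<^sub>R b"
    and lat: "\<And>x. x \<in> lat \<Longrightarrow> \<exists>m n. x = real_of_int m *\<^sub>R a + real_of_int n *\<^sub>R b"
    using lattice_basis[OF assms] by blast
  have spanR: "span R = UNIV" by (rule full_lattice_span[OF full])
  define pt where "pt m n = real_of_int m *\<^sub>R a + real_of_int n *\<^sub>R b" for m n
  have pt_lat: "pt m n \<in> lat" for m n
    using zspan_lin[of a A b] aL bL unfolding pt_def lat_def by blast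
  have pt_add: "pt (m + p) (n + q) = pt m n + pt p q" for m n p q
    by (simp add: pt_def algebra_simps)
  have pt_diff: "pt (m - p) (n - q) = pt m n - pt p q" for m n p q
    by (simp add: pt_def algebra_simps)
  have pt_2: "pt (2 * p) (2 * q) = 2 *\<^sub>R pt p q" for p q
    by (simp add: pt_def algebra_simps)
  have pt_inj: "m = p \<and> n = q" if "pt m n = pt p q" for m n p q
  proof -
    have "real_of_int (m - p) *\<^sub>R a + real_of_int (n - q) *\<^sub>R b = 0"
      using that by (simp add: pt_def algebra_simps)
    from ind[OF this] show ?thesis by simp
  qed
  define co where "co X = {(m, n). pt m n \<in> X}" for X
  have coI: "(m, n) \<in> co X \<longleftrightarrow> pt m n \<in> X" for m n X by (simp add: co_def)
  have pt0: "pt 0 0 = 0" by (simp add: pt_def)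
  \<comment> \<open>\<open>A\<close> generates the lattice, so no nonzero homomorphism to Z/2
    vanishes on it; the three choices of (r, s) modulo 2 give the three parity conditions.\<close>
  have odd_ex: "\<exists>(m, n)\<in>co A. odd (r * m + s * n)" if rs: "odd r \<or> odd s" for r s :: int
  proof (rule ccontr)
    assume "\<not> ?thesis"
    then have ev: "even (r * m + s * n)" if "pt m n \<in> A" for m n using that by (auto simp: co_def)
    have all: "\<exists>m n. x = pt m n \<and> even (r * m + s * n)" if "x \<in> lat" for x
      using that unfolding lat_def
    proof (induction rule: zspan_induct)
      case zero
      show ?case by (intro exI[of _ 0]) (simp add: pt0)
    next
      case (add y z)
      obtain m n where y: "y = pt m n" "even (r * m + s * n)" using add by blast
      obtain p q where z: "z = pt p q" using lat A_lat add(2) unfolding pt_def by blast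
      have "even (r * (m + p) + s * (n + q))" using y ev add z by (simp add: algebra_simps)
      then show ?case unfolding y z pt_add[symmetric] by blast
    next
      case (diff y z)
      obtain m n where y: "y = pt m n" "even (r * m + s * n)" using diff by blast
      obtain p q where z: "z = pt p q" using lat A_lat diff(2) unfolding pt_def by blast
      have "even (r * (m - p) + s * (n - q))" using y ev diff z by (simp add: algebra_simps)
      then show ?case unfolding y z pt_diff[symmetric] by blast
    qed
    have "even r" using all[OF pt_lat, of 1 0] pt_inj by fastforce
    moreover have "even s" using all[OF pt_lat, of 0 1] pt_inj by fastforce
    ultimately show False using rs by blast
  qed
  have adm: "admissible l (co A) (co M) (co C)"
  proof unfold_locales
    show "\<exists>(m, n)\<in>co A. odd m" "\<exists>(m, n)\<in>co A. odd n" "\<exists>(m, n)\<in>co A. odd (m + n)"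
      using odd_ex[of 1 0] odd_ex[of 0 1] odd_ex[of 1 1] by simp_all
  qed (simp_all add: coI pt0 zero_mem zero_M pt_2 pt_add A_period M_period A_M M_C C_M M_add pt_lat)
  define emb where "emb v = (\<Sum>i<l. v i *\<^sub>R e i) + (v l *\<^sub>R a + v (l + 1) *\<^sub>R b)" for v :: "nat \<Rightarrow> real"
  have emb_mvec: "emb (mvec l v m n) = (\<Sum>i<l. v i *\<^sub>R e i) + pt m n" for v m n
  proof -
    have "(\<Sum>i<l. mvec l v m n i *\<^sub>R e i) = (\<Sum>i<l. v i *\<^sub>R e i)"
      by (rule sum.cong) (auto simp: mvec_def)
    then show ?thesis by (simp add: emb_def pt_def mvec_def)
  qed
  have ab_rad: "a \<in> radical I" "b \<in> radical I" using aL bL lat_rad by auto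
  have emb_add: "emb (\<lambda>i. u i + v i) = emb u + emb v" for u v
    by (simp add: emb_def scaleR_add_left sum.distrib)
  have emb_scale: "emb (\<lambda>i. c * v i) = c *\<^sub>R emb v" for c v
    by (simp add: emb_def scaleR_add_right scaleR_sum_right)
  have emb_zero: "v = (\<lambda>_. 0)" if v: "v \<in> model_space l" and z: "emb v = 0" for v
  proof -
    have r: "v l *\<^sub>R a + v (l + 1) *\<^sub>R b \<in> radical I"
      using ab_rad subspace_radical by (simp add: subspace_add subspace_scale)
    have vi: "v i = 0" if i: "i < l" for i
      using coefficient[OF i r, of v] q_pos unfolding z[unfolded emb_def] by (simp add: form_simps)
    then have "v l *\<^sub>R a + v (l + 1) *\<^sub>R b = 0" using z by (simp add: emb_def)
    from ind[OF this] have "v l = 0" "v (l + 1) = 0" by auto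
    moreover have "i < l \<or> i = l \<or> i = l + 1 \<or> i \<ge> l + 2" for i by auto
    ultimately show ?thesis using vi v by (metis (mono_tags, lifting) mem_Collect_eq model_space_def)
  qed
  have bij: "bij_betw emb (model_space l) UNIV"
  proof (rule bij_betw_imageI)
    show "inj_on emb (model_space l)"
    proof (rule inj_onI)
      fix u v assume u: "u \<in> model_space l" and v: "v \<in> model_space l" and eq: "emb u = emb v"
      have "emb (\<lambda>i. u i + (-1) * v i) = 0" unfolding emb_add emb_scale eq by simp
      moreover have "(\<lambda>i. u i + (-1) * v i) \<in> model_space l" using u v by (simp add: model_space_def)
      ultimately have "(\<lambda>i. u i + (-1) * v i) = (\<lambda>_. 0)" by (intro emb_zero)
      then show "u = v" by (auto simp: fun_eq_iff)
    qed
    show "emb ` model_space l = UNIV"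
    proof (intro equalityI subsetI)
      fix x
      obtain n d where d: "d \<in> span A" "x = (\<Sum>i<l. n i *\<^sub>R e i) + d"
        using span_R_decomp[of x] spanR by auto
      have "d \<in> radical I" using d(1) radical_span_A[OF spanR] by simp
      then obtain c k where ck: "d = c *\<^sub>R a + k *\<^sub>R b" using rad by blast
      let ?v = "\<lambda>i. if i < l then n i else if i = l then c else if i = l + 1 then k else 0"
      have "(\<Sum>i<l. ?v i *\<^sub>R e i) = (\<Sum>i<l. n i *\<^sub>R e i)" by (rule sum.cong) auto
      then have "emb ?v = x" unfolding emb_def by (simp add: d ck)
      moreover have "?v \<in> model_space l" by (simp add: model_space_def)
      ultimately show "x \<in> emb ` model_space l" by blast
    qed simp
  qed
  have "R = emb ` mroots l (co A) (co M) (co C)"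
  proof (intro equalityI subsetI)
    fix x assume x: "x \<in> R"
    obtain v d where v: "v \<in> BCs l \<union> BCm l \<union> BCl l" and d: "d \<in> lat"
      and xd: "x = (\<Sum>i<l. v i *\<^sub>R e i) + d" using root_lat[OF x] by blast
    obtain m n where mn: "d = pt m n" using lat[OF d] unfolding pt_def by blast
    have dr: "d \<in> radical I" using d lat_rad by blast
    \<comment> \<open>A middle vector exists only for \<open>l \<ge> 2\<close>, where
      \<open>M\<close> is the true middle fibre; the substitute for l = 1 never produces a
      root.\<close>
    have "v \<in> BCm l \<Longrightarrow> M = B" by (rule M_large) (auto simp: BCm_def)
    then have "mvec l v m n \<in> mroots l (co A) (co M) (co C)"
      using sum_mem_iff[OF dr, of v] x xd v mn unfolding mroots_def coI by blast
    moreover have "x = emb (mvec l v m n)" unfolding emb_mvec xd mn ..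
    ultimately show "x \<in> emb ` mroots l (co A) (co M) (co C)" by blast
  next
    fix x assume "x \<in> emb ` mroots l (co A) (co M) (co C)"
    then obtain v m n where x: "x = emb (mvec l v m n)"
      and c: "v \<in> BCs l \<and> pt m n \<in> A \<or> v \<in> BCm l \<and> pt m n \<in> M \<or> v \<in> BCl l \<and> pt m n \<in> C"
      unfolding mroots_def coI by blast
    have dr: "pt m n \<in> radical I" using pt_lat lat_rad by blast
    have "v \<in> BCm l \<Longrightarrow> M = B" by (rule M_large) (auto simp: BCm_def)
    then show "x \<in> R" using sum_mem_iff[OF dr, of v] c unfolding x emb_mvec by blast
  qed
  moreover have "mroots l (co A) (co M) (co C) \<subseteq> model_space l"
    by (auto simp: mroots_def mvec_def model_space_def)
  moreover have "G = emb ` model_G l"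
  proof -
    have "emb (\<lambda>i. if i = l then c else 0) = c *\<^sub>R a" for c
      by (simp add: emb_def)
    then have "emb ` model_G l = range (\<lambda>c. c *\<^sub>R a)"
      unfolding model_G_def by (auto simp: image_iff) metis
    then show ?thesis unfolding G span_singleton by simp
  qed
  ultimately have "iso_to_model l R G (mroots l (co A) (co M) (co C))"
    by (intro iso_to_modelI[of emb]) (use emb_add emb_scale bij in auto)
  then show thesis using that adm by blast
qed

end

section \<open>Automorphisms of the model space\<close>

lemma nonreduced_framed:
  assumes dim: "DIM('a::euclidean_space) = l + 2"
    and R: "elliptic_root_system l I R" and nr: "\<not> reduced R"
  obtains e0 e where "framed_roots I R (e0::'a) l e"
proof -
  have I: "sym_bilinear_form I" "has_signature I l 2 0" and gen: "generalized_root_system I R"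
    using R by (auto simp: elliptic_root_system_def)
  interpret semidefinite_form I using signature_semidefinite[OF I] by blast
  have wref: "wref I x y = y - (2 * I x y / I x x) *\<^sub>R x" for x y
    by (simp add: wref_def coroot_def form_simps sym[of y x])
  have coroot: "I (coroot I x) y = 2 * I x y / I x x" for x y
    by (simp add: coroot_def form_simps)
  obtain e0 where e0: "e0 \<in> R" "2 *\<^sub>R e0 \<in> R"
  proof -
    obtain x where x: "x \<in> R" "2 *\<^sub>R x \<in> R \<or> (1/2) *\<^sub>R x \<in> R" using nr unfolding reduced_def by blast
    then show thesis using that[of x] that[of "(1/2) *\<^sub>R x"] by auto
  qed
  interpret nonreduced_roots I R e0
  proof unfold_locales
    fix x y assume xy: "x \<in> R" "y \<in> R"
    have "wref I x ` R = R" using gen xy unfolding generalized_root_system_def by blast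
    then have "wref I x y \<in> R" using xy by blast
    then show "y - (2 * I x y / I x x) *\<^sub>R x \<in> R" unfolding wref .
    show "2 * I x y / I x x \<in> \<int>"
      using gen xy unfolding generalized_root_system_def coroot by blast
  next
    fix R1 R2 assume "R = R1 \<union> R2" "\<And>x y. x \<in> R1 \<Longrightarrow> y \<in> R2 \<Longrightarrow> I x y = 0"
    then show "R1 = {} \<or> R2 = {}" using gen unfolding generalized_root_system_def by metis
  qed (use gen e0 in \<open>auto simp: generalized_root_system_def\<close>)
  have "full_lattice_in (zspan R) UNIV" using gen by (simp add: generalized_root_system_def)
  then have "span R = UNIV" by (rule full_lattice_span)
  then show thesis
    using frame_enumeration[OF dim signature_semidefinite(2)[OF I]] that by blast
qed

lemma elliptic_coordinates:
  assumes "DIM('a::euclidean_space) = l + 2"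
    and R: "marked_elliptic_root_system l I R (G :: 'a set)" and "\<not> reduced R"
  obtains A B C where "admissible l A B C" "iso_to_model l R G (mroots l A B C)"
proof -
  have R': "elliptic_root_system l I R" "marking I R G"
    using R by (auto simp: marked_elliptic_root_system_def)
  obtain e0 e where "framed_roots I R e0 l e" using nonreduced_framed[OF assms(1) R'(1) assms(3)] by blast
  then interpret framed_roots I R e0 l e .
  have "full_lattice_in (zspan R) UNIV" "sym_bilinear_form I" "has_signature I l 2 0"
    using R'(1) by (auto simp: elliptic_root_system_def generalized_root_system_def)
  then show thesis using coordinates[OF _ R'(2) signature_semidefinite(2)] that by blast
qed

text \<open>The linear automorphism of the model space that shears \<open>b\<close> by \<open>k a\<close> and moves each
  \<open>\<epsilon>\<^sub>i\<close> by \<open>p i a + q i b\<close>.\<close>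
definition shear :: "nat \<Rightarrow> int \<Rightarrow> (nat \<Rightarrow> int) \<Rightarrow> (nat \<Rightarrow> int) \<Rightarrow> (nat \<Rightarrow> real) \<Rightarrow> nat \<Rightarrow> real" where
  "shear l k p q v = (\<lambda>i.
     if i = l then v l + k * v (l + 1) + (\<Sum>j<l. p j * v j)
     else if i = l + 1 then v (l + 1) + (\<Sum>j<l. q j * v j) else v i)"

text \<open>The inverse shears a b-coordinate that has already been translated by \<open>q\<close>,
  hence the correction \<open>k * q j - p j\<close>.\<close>

lemma bij_shear: "bij_betw (shear l k p q) (model_space l) (model_space l)"
proof (rule bij_betw_byWitness[where f' =
    "\<lambda>v. shear l (- k) (\<lambda>j. k * q j - p j) (\<lambda>j. - q j) v"])
  show "\<forall>v\<in>model_space l. shear l (- k) (\<lambda>j. k * q j - p j) (\<lambda>j. - q j) (shear l k p q v) = v"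
    by (auto simp: shear_def fun_eq_iff algebra_simps sum_distrib_left sum_subtractf sum_negf)
  show "\<forall>v\<in>model_space l. shear l k p q (shear l (- k) (\<lambda>j. k * q j - p j) (\<lambda>j. - q j) v) = v"
    by (auto simp: shear_def fun_eq_iff algebra_simps sum_distrib_left sum_subtractf sum_negf)
qed (auto simp: shear_def model_space_def)

lemma iso_shear:
  assumes iso: "iso_to_model l R G R'" and R': "R' \<subseteq> model_space l"
  shows "iso_to_model l R G (shear l k p q ` R')"
proof -
  let ?S = "shear l k p q"
  obtain \<phi> :: "'a \<Rightarrow> nat \<Rightarrow> real" where add: "\<And>x y. \<phi> (x + y) = (\<lambda>i. \<phi> x i + \<phi> y i)"
    and scale: "\<And>c x. \<phi> (c *\<^sub>R x) = (\<lambda>i. c * \<phi> x i)"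
    and bij: "bij_betw \<phi> UNIV (model_space l)" and R: "\<phi> ` R = R'" and G: "\<phi> ` G = model_G l"
    using iso unfolding iso_to_model_def by blast
  have lin: "?S (\<lambda>i. u i + v i) = (\<lambda>i. ?S u i + ?S v i)" "?S (\<lambda>i. c * v i) = (\<lambda>i. c * ?S v i)" for u v c
    by (auto simp: shear_def fun_eq_iff algebra_simps sum.distrib sum_distrib_left)
  have "?S v = v" if "v \<in> model_G l" for v
    using that by (auto simp: model_G_def shear_def fun_eq_iff)
  then have SG: "?S ` model_G l = model_G l" by force
  show ?thesis unfolding iso_to_model_def
  proof (intro exI[of _ "?S \<circ> \<phi>"] conjI allI)
    show "bij_betw (?S \<circ> \<phi>) UNIV (model_space l)" using bij bij_shear by (rule bij_betw_trans)
    show "(?S \<circ> \<phi>) ` R = ?S ` R'" "(?S \<circ> \<phi>) ` G = model_G l"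
      by (simp_all only: image_comp[symmetric] R G SG)
  qed (simp_all add: add scale lin)
qed

lemma shear_mvec:
  assumes "(\<Sum>j<l. p j * v j) = real_of_int p'" "(\<Sum>j<l. q j * v j) = real_of_int q'"
  shows "shear l k p q (mvec l v m n) = mvec l v (m + k * n + p') (n + q')"
proof -
  have "(\<Sum>j<l. f j * mvec l v m n j) = (\<Sum>j<l. f j * v j)" for f :: "nat \<Rightarrow> real"
    by (rule sum.cong) (auto simp: mvec_def)
  then show ?thesis using assms by (auto simp: shear_def fun_eq_iff mvec_def)
qed

lemma sum_axis: "i < (l::nat) \<Longrightarrow> (\<Sum>j<l. f j * (if j = i then s else 0)) = f i * (s::real)"
proof -
  assume i: "i < l"
  have "(\<Sum>j<l. f j * (if j = i then s else 0)) = (\<Sum>j<l. if j = i then f i * s else 0)"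
    by (rule sum.cong) auto
  then show ?thesis using i by simp
qed

lemma sum_two_axes:
  assumes "i < j" "j < (l::nat)"
  shows "(\<Sum>k<l. f k * (if k = i then s else if k = j then t else 0)) = f i * s + f j * (t::real)"
proof -
  have "(\<Sum>k<l. f k * (if k = i then s else if k = j then t else 0)) =
    (\<Sum>k<l. f k * (if k = i then s else 0) + f k * (if k = j then t else 0))"
    by (rule sum.cong) (use assms in auto)
  also have "\<dots> = f i * s + f j * t"
    unfolding sum.distrib using assms sum_axis[of i l f s] sum_axis[of j l f t] by linarith
  finally show ?thesis .
qed

definition fibred :: "nat \<Rightarrow> (nat \<Rightarrow> real) set \<Rightarrow> (int \<times> int) set \<Rightarrow> (nat \<Rightarrow> real) set" where
  "fibred l V X = {mvec l v m n | v m n. v \<in> V \<and> (m, n) \<in> X}"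

lemma mroots_fibred: "mroots l A B C = fibred l (BCs l) A \<union> fibred l (BCm l) B \<union> fibred l (BCl l) C"
  unfolding mroots_def fibred_def by blast

lemma mroots_model_space: "mroots l A B C \<subseteq> model_space l"
  by (auto simp: mroots_def mvec_def model_space_def)

lemma shear_fibred:
  assumes "\<And>v. v \<in> V \<Longrightarrow> \<exists>p' q'. (\<Sum>j<l. p j * v j) = real_of_int p' \<and> (\<Sum>j<l. q j * v j) = real_of_int q' \<and>
    (\<forall>m n. (m, n) \<in> X \<longleftrightarrow> (m + k * n + p', n + q') \<in> X')"
  shows "shear l k p q ` fibred l V X = fibred l V X'"
proof (intro equalityI subsetI)
  fix x assume "x \<in> shear l k p q ` fibred l V X"
  then obtain v m n where x: "x = shear l k p q (mvec l v m n)" "v \<in> V" "(m, n) \<in> X"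
    by (auto simp: fibred_def)
  obtain p' q' where pq: "(\<Sum>j<l. p j * v j) = real_of_int p'" "(\<Sum>j<l. q j * v j) = real_of_int q'"
    "\<forall>m n. (m, n) \<in> X \<longleftrightarrow> (m + k * n + p', n + q') \<in> X'" using assms x by meson
  show "x \<in> fibred l V X'"
    unfolding x shear_mvec[OF pq(1,2)] fibred_def using x pq(3) by blast
next
  fix x assume "x \<in> fibred l V X'"
  then obtain v m n where x: "x = mvec l v m n" "v \<in> V" "(m, n) \<in> X'"
    by (auto simp: fibred_def)
  obtain p' q' where pq: "(\<Sum>j<l. p j * v j) = real_of_int p'" "(\<Sum>j<l. q j * v j) = real_of_int q'"
    "\<forall>m n. (m, n) \<in> X \<longleftrightarrow> (m + k * n + p', n + q') \<in> X'" using assms x by meson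
  have "(m - k * (n - q') - p', n - q') \<in> X" using pq(3) x(3) by simp
  moreover have "x = shear l k p q (mvec l v (m - k * (n - q') - p') (n - q'))"
    unfolding x shear_mvec[OF pq(1,2)] by simp
  ultimately show "x \<in> shear l k p q ` fibred l V X" unfolding fibred_def using x(2) by blast
qed

text \<open>The periods absorb the difference between the translations of a root and of its images
  under sign changes.\<close>
lemma iso_transform:
  assumes iso: "iso_to_model l R G (mroots l A B C)"
    and A: "\<And>m n i. i < l \<Longrightarrow> (m, n) \<in> A \<longleftrightarrow> (m + k * n + p i, n + q i) \<in> A'"
    and A0: "\<And>m n r s. (m + 2 * r, n + 2 * s) \<in> A' \<longleftrightarrow> (m, n) \<in> A'"
    and B: "\<And>m n i j. i < j \<Longrightarrow> j < l \<Longrightarrow> (m, n) \<in> B \<longleftrightarrow> (m + k * n + p i + p j, n + q i + q j) \<in> B'"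
    and B0: "\<And>m n r s. (m + 2 * r, n + 2 * s) \<in> B' \<longleftrightarrow> (m, n) \<in> B'"
    and C: "\<And>m n i. i < l \<Longrightarrow> (m, n) \<in> C \<longleftrightarrow> (m + k * n + 2 * p i, n + 2 * q i) \<in> C'"
    and C0: "\<And>m n r s. (m + 4 * r, n + 4 * s) \<in> C' \<longleftrightarrow> (m, n) \<in> C'"
  shows "iso_to_model l R G (mroots l A' B' C')"
proof -
  have "shear l k p q ` fibred l (BCs l) A = fibred l (BCs l) A'"
  proof (rule shear_fibred)
    fix v assume "v \<in> BCs l"
    then obtain i s where v: "v = (\<lambda>k. if k = i then s else 0)" and i: "i < l" and s: "s = 1 \<or> s = -1"
      unfolding BCs_def by blast
    obtain t :: int where t: "s = real_of_int t" "t = 1 \<or> t = -1" using s by force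
    have "(m + k * n + t * p i, n + t * q i) \<in> A' \<longleftrightarrow> (m + k * n + p i, n + q i) \<in> A'" for m n
      using A0[of "m + k * n + p i" "- p i" "n + q i" "- q i"] t(2) by (auto simp: algebra_simps)
    then show "\<exists>p' q'. (\<Sum>j<l. p j * v j) = real_of_int p' \<and> (\<Sum>j<l. q j * v j) = real_of_int q' \<and>
      (\<forall>m n. (m, n) \<in> A \<longleftrightarrow> (m + k * n + p', n + q') \<in> A')"
      unfolding v using A[OF i] sum_axis[OF i] t(1)
      by (intro exI[of _ "t * p i"] exI[of _ "t * q i"]) (simp add: mult.commute)
  qed
  moreover have "shear l k p q ` fibred l (BCl l) C = fibred l (BCl l) C'"
  proof (rule shear_fibred)
    fix v assume "v \<in> BCl l"
    then obtain i s where v: "v = (\<lambda>k. if k = i then s else 0)" and i: "i < l" and s: "s = 2 \<or> s = -2"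
      unfolding BCl_def by blast
    obtain t :: int where t: "s = real_of_int t" "t = 2 \<or> t = -2" using s by force
    have "(m + k * n + t * p i, n + t * q i) \<in> C' \<longleftrightarrow> (m + k * n + 2 * p i, n + 2 * q i) \<in> C'" for m n
      using C0[of "m + k * n + 2 * p i" "- p i" "n + 2 * q i" "- q i"] t(2) by (auto simp: algebra_simps)
    then show "\<exists>p' q'. (\<Sum>j<l. p j * v j) = real_of_int p' \<and> (\<Sum>j<l. q j * v j) = real_of_int q' \<and>
      (\<forall>m n. (m, n) \<in> C \<longleftrightarrow> (m + k * n + p', n + q') \<in> C')"
      unfolding v using C[OF i] sum_axis[OF i] t(1)
      by (intro exI[of _ "t * p i"] exI[of _ "t * q i"]) (simp add: mult.commute)
  qed
  moreover have "shear l k p q ` fibred l (BCm l) B = fibred l (BCm l) B'"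
  proof (rule shear_fibred)
    fix v assume "v \<in> BCm l"
    then obtain i j s s' where v: "v = (\<lambda>k. if k = i then s else if k = j then s' else 0)"
      and ij: "i < j" "j < l" and s: "s = 1 \<or> s = -1" "s' = 1 \<or> s' = -1"
      unfolding BCm_def by blast
    \<comment> \<open>Writing a sign as 1 - 2t exhibits the difference between signed and unsigned
      translations as an even vector, which the period of \<open>B'\<close> absorbs.\<close>
    obtain t t' :: int where t: "s = real_of_int (1 - 2 * t)" "s' = real_of_int (1 - 2 * t')"
    proof -
      have "\<exists>t :: int. x = real_of_int (1 - 2 * t)" if "x = 1 \<or> x = -1" for x :: real
        using that by (elim disjE; intro exI[of _ "if x = 1 then 0 else 1"]) simp_all
      then show thesis using that s by blast
    qed
    have "(m + k * n + ((1 - 2 * t) * p i + (1 - 2 * t') * p j), n + ((1 - 2 * t) * q i + (1 - 2 * t') * q j)) \<in> B'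
        \<longleftrightarrow> (m + k * n + p i + p j, n + q i + q j) \<in> B'" for m n
      using B0[of "m + k * n + p i + p j" "- t * p i - t' * p j" "n + q i + q j" "- t * q i - t' * q j"]
      by (simp add: algebra_simps)
    then show "\<exists>p' q'. (\<Sum>j<l. p j * v j) = real_of_int p' \<and> (\<Sum>j<l. q j * v j) = real_of_int q' \<and>
      (\<forall>m n. (m, n) \<in> B \<longleftrightarrow> (m + k * n + p', n + q') \<in> B')"
      unfolding v using B[OF ij] sum_two_axes[OF ij] t
      by (intro exI[of _ "(1 - 2 * t) * p i + (1 - 2 * t') * p j"]
          exI[of _ "(1 - 2 * t) * q i + (1 - 2 * t') * q j"]) (simp add: mult.commute)
  qed
  ultimately show ?thesis
    using iso_shear[OF iso mroots_model_space, of k p q] by (simp add: mroots_fibred image_Un)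
qed

text \<open>Residue classes modulo \<open>2u\<close>, \<open>2v\<close> of the pairs of multiples of \<open>u\<close> and \<open>v\<close>: the four
  flags say whether the classes of \<open>(0, 0)\<close>, \<open>(u, 0)\<close>, \<open>(0, v)\<close>, \<open>(u, v)\<close> are included.\<close>
definition quad :: "int \<Rightarrow> int \<Rightarrow> bool \<Rightarrow> bool \<Rightarrow> bool \<Rightarrow> bool \<Rightarrow> (int \<times> int) set" where
  "quad u v z x y w = {(u * m, v * n) | m n.
     if even m then (if even n then z else y) else (if even n then x else w)}"

section \<open>Periodic sets of lattice points described by four flags\<close>

lemma quad_iff:
  assumes "u \<noteq> 0" "v \<noteq> 0"
  shows "(m, n) \<in> quad u v z x y w \<longleftrightarrow> u dvd m \<and> v dvd n \<and>
    (if even (m div u) then (if even (n div v) then z else y) else (if even (n div v) then x else w))"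
    (is "_ \<longleftrightarrow> _ \<and> _ \<and> ?c (m div u) (n div v)")
proof
  assume "(m, n) \<in> quad u v z x y w"
  then obtain m' n' where "m = u * m'" "n = v * n'" "?c m' n'" unfolding quad_def by blast
  then show "u dvd m \<and> v dvd n \<and> ?c (m div u) (n div v)" using assms by simp
next
  assume "u dvd m \<and> v dvd n \<and> ?c (m div u) (n div v)"
  then show "(m, n) \<in> quad u v z x y w"
    unfolding quad_def by (intro CollectI exI[of _ "m div u"] exI[of _ "n div v"]) auto
qed

lemmas quad_mems = quad_iff[of 1 1, simplified] quad_iff[of 1 2, simplified]
  quad_iff[of 2 1, simplified] quad_iff[of 2 2, simplified]

lemma quadI:
  assumes "\<And>m n. P m n \<longleftrightarrow> (if even m then (if even n then z else y) else (if even n then x else w))"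
  shows "{(u * m, v * n) | m n. P m n} = quad u v z x y w"
  unfolding quad_def assms ..

lemma pL_mult: "pL (c * u) (d * v) = {(u * m, v * n) | m n. c dvd m \<and> d dvd n}"
proof (intro equalityI subsetI)
  fix x assume "x \<in> pL (c * u) (d * v)"
  then obtain m n where "x = (u * (c * m), v * (d * n))" by (auto simp: pL_def ac_simps)
  then show "x \<in> {(u * m, v * n) | m n. c dvd m \<and> d dvd n}"
    by (intro CollectI exI[of _ "c * m"] exI[of _ "d * n"]) simp
next
  fix x assume "x \<in> {(u * m, v * n) | m n. c dvd m \<and> d dvd n}"
  then obtain m n where "x = (u * (c * m), v * (d * n))" by (auto simp: dvd_def)
  then have "x = (c * u * m, d * v * n)" by (simp add: ac_simps)
  then show "x \<in> pL (c * u) (d * v)" unfolding pL_def by blast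
qed

lemma quad_pL:
  "quad u v True True True True = pL u v"
  "quad u v True False True False = pL (2 * u) v"
  "quad u v True True False False = pL u (2 * v)"
  "quad u v True False False False = pL (2 * u) (2 * v)"
proof -
  show "quad u v True True True True = pL u v"
    using pL_mult[of 1 u 1 v] by (subst quadI[symmetric, of "\<lambda>m n. 1 dvd m \<and> 1 dvd n"]) simp_all
  show "quad u v True False True False = pL (2 * u) v"
    using pL_mult[of 2 u 1 v] by (subst quadI[symmetric, of "\<lambda>m n. 2 dvd m \<and> 1 dvd n"]) simp_all
  show "quad u v True True False False = pL u (2 * v)"
    using pL_mult[of 1 u 2 v] by (subst quadI[symmetric, of "\<lambda>m n. 1 dvd m \<and> 2 dvd n"]) simp_all
  show "quad u v True False False False = pL (2 * u) (2 * v)"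
    using pL_mult[of 2 u 2 v] by (subst quadI[symmetric, of "\<lambda>m n. 2 dvd m \<and> 2 dvd n"]) simp_all
qed

lemma pL_mem: "(m, n) \<in> pL p q \<longleftrightarrow> p dvd m \<and> q dvd n"
  by (auto simp: pL_def dvd_def)

text \<open>Periodicity leaves four classes with representatives (0,0), (u,0), (0,v), (u,v). This
  turns each unknown fibre into four truth values and the remaining problem into a finite
  one.\<close>

lemma quad_eqI:
  assumes sub: "C \<subseteq> pL u v"
    and per: "\<And>m n p q. (m, n) \<in> C \<Longrightarrow> (p, q) \<in> pL u v \<Longrightarrow> (m + 2 * p, n + 2 * q) \<in> C"
  shows "C = quad u v ((0, 0) \<in> C) ((u, 0) \<in> C) ((0, v) \<in> C) ((u, v) \<in> C)"
proof -
  have per': "(m + 2 * (u * r), n + 2 * (v * s)) \<in> C \<longleftrightarrow> (m, n) \<in> C" for m n r s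
    using per[of m n "u * r" "v * s"] per[of "m + 2 * (u * r)" "n + 2 * (v * s)" "u * - r" "v * - s"]
    by (auto simp: pL_mem)
  have key: "(u * m, v * n) \<in> C \<longleftrightarrow> (if even m then (if even n then (0, 0) \<in> C else (0, v) \<in> C)
      else (if even n then (u, 0) \<in> C else (u, v) \<in> C))" for m n
  proof -
    have "u * (m mod 2) + 2 * (u * (m div 2)) = u * m" "v * (n mod 2) + 2 * (v * (n div 2)) = v * n"
      by (metis distrib_left mod_mult_div_eq mult.left_commute)+
    then have "(u * m, v * n) \<in> C \<longleftrightarrow> (u * (m mod 2), v * (n mod 2)) \<in> C"
      using per'[of "u * (m mod 2)" "m div 2" "v * (n mod 2)" "n div 2"] by simp
    then show ?thesis by (simp add: mod2_eq_if)
  qed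
  show ?thesis unfolding quad_def key[symmetric] using sub unfolding pL_def by blast
qed

lemma Lsij_quad:
  "Lsij s t 0 0 = quad t s True True True False"
  "Lsij s t 1 1 = quad t s False True True True"
  "Lsij s t 1 0 = quad t s True True False True"
  "Lsij s t 0 1 = quad t s True False True True"
  unfolding Lsij_def by (rule quadI, simp)+

lemma Lij_quad:
  "Lij 0 0 = quad 1 1 True True True False"
  "Lij 1 1 = quad 1 1 False True True True"
  "Lij 0 1 = quad 1 1 True False True True"
proof -
  have "Lij i j = Lsij 1 1 i j" for i j by (auto simp: Lij_def Lsij_def)
  then show "Lij 0 0 = quad 1 1 True True True False" "Lij 1 1 = quad 1 1 False True True True"
    "Lij 0 1 = quad 1 1 True False True True" by (simp_all add: Lsij_quad)
qed

lemma diamond_quad: "{(m, 2 * n) | m n :: int. even (m - n)} = quad 1 2 True False False True"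
proof -
  have "{(1 * m, 2 * n) | m n :: int. even (m - n)} = quad 1 2 True False False True"
    by (rule quadI) auto
  then show ?thesis by simp
qed

section \<open>Classification of the fibres\<close>

text \<open>The flags \<open>z, x, y, w\<close> describe the short roots and \<open>z', x', y', w'\<close> the
  long ones, while the middle roots are translated by the full lattice with steps \<open>u\<close>, \<open>v\<close>.\<close>
definition state :: "nat \<Rightarrow> 'a::real_vector set \<Rightarrow> 'a set \<Rightarrow> int \<Rightarrow> int \<Rightarrow>
    bool \<Rightarrow> bool \<Rightarrow> bool \<Rightarrow> bool \<Rightarrow> bool \<Rightarrow> bool \<Rightarrow> bool \<Rightarrow> bool \<Rightarrow> bool" where
  "state l R G u v z x y w z' x' y' w' \<longleftrightarrow>
     iso_to_model l R G (mroots l (quad 1 1 z x y w) (pL u v) (quad u v z' x' y' w'))"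

section \<open>Effect of shears and translations on the flags\<close>

lemma quad_period:
  "(m + 2 * r, n + 2 * s) \<in> quad 1 1 z x y w \<longleftrightarrow> (m, n) \<in> quad 1 1 z x y w"
  "(m + 4 * r, n + 4 * s) \<in> quad 1 1 z x y w \<longleftrightarrow> (m, n) \<in> quad 1 1 z x y w"
  "(m + 4 * r, n + 4 * s) \<in> quad 1 2 z x y w \<longleftrightarrow> (m, n) \<in> quad 1 2 z x y w"
  "(m + 4 * r, n + 4 * s) \<in> quad 2 1 z x y w \<longleftrightarrow> (m, n) \<in> quad 2 1 z x y w"
  "(m + 4 * r, n + 4 * s) \<in> quad 2 2 z x y w \<longleftrightarrow> (m, n) \<in> quad 2 2 z x y w"
proof -
  have d: "even (m + 4 * r) \<longleftrightarrow> even m" "even ((m + 4 * r) div 2) \<longleftrightarrow> even (m div 2)" for m r :: int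
    by presburger+
  show "(m + 2 * r, n + 2 * s) \<in> quad 1 1 z x y w \<longleftrightarrow> (m, n) \<in> quad 1 1 z x y w"
    by (simp add: quad_mems)
  show "(m + 4 * r, n + 4 * s) \<in> quad 1 1 z x y w \<longleftrightarrow> (m, n) \<in> quad 1 1 z x y w"
    "(m + 4 * r, n + 4 * s) \<in> quad 1 2 z x y w \<longleftrightarrow> (m, n) \<in> quad 1 2 z x y w"
    "(m + 4 * r, n + 4 * s) \<in> quad 2 1 z x y w \<longleftrightarrow> (m, n) \<in> quad 2 1 z x y w"
    "(m + 4 * r, n + 4 * s) \<in> quad 2 2 z x y w \<longleftrightarrow> (m, n) \<in> quad 2 2 z x y w"
    by (simp_all only: quad_mems d div_by_1)
qed

lemma pL_period:
  assumes "u \<in> {1, 2}" "v \<in> {1, 2}"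
  shows "(m + 2 * r, n + 2 * s) \<in> pL u v \<longleftrightarrow> (m, n) \<in> pL u v"
  using assms by (auto simp: pL_mem)

lemma half_shift: "even ((m + 2) div 2) \<longleftrightarrow> odd (m div 2)" "even ((m + 2 * n) div 2) \<longleftrightarrow> even (m div 2 + n)"
  for m n :: int
  by presburger+

lemma half_add: "even m \<Longrightarrow> even n \<Longrightarrow> even ((m + n) div 2) \<longleftrightarrow> even (m div 2 + n div 2)"
  for m n :: int
  by presburger

text \<open>The shear of b by a adds n to the a-coordinate. With equal steps it swaps (0,v) and
  (u,v) among the long classes just as it swaps (0,1) and (1,1) among the short ones.\<close>

lemma state_shear:
  assumes "u = v"
  shows "u \<in> {1, 2} \<Longrightarrow> state l R G u v z x y w z' x' y' w' \<Longrightarrow> state l R G u v z x w y z' x' w' y'"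
  unfolding state_def assms
  by (erule iso_transform[where k = 1 and p = "\<lambda>_. 0" and q = "\<lambda>_. 0"])
    (auto simp: quad_period pL_period quad_mems pL_mem half_add)

text \<open>Here k = 2, because the shear by a alone does not preserve the middle lattice with steps
  2 and 1.\<close>

lemma state_shear_21:
  assumes "state l R G 2 1 True True True True z x y w"
  shows "state l R G 2 1 True True True True z x w y"
  using assms unfolding state_def
  by (elim iso_transform[where k = 2 and p = "\<lambda>_. 0" and q = "\<lambda>_. 0"])
    (auto simp: quad_period pL_period quad_mems pL_mem half_shift)

lemma state_shift_21:
  assumes "state l R G 2 1 True True True True z x y w"
  shows "state l R G 2 1 True True True True x z w y"
  using assms unfolding state_def
  by (elim iso_transform[where k = 0 and p = "\<lambda>_. 1" and q = "\<lambda>_. 0"])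
    (auto simp: quad_period pL_period quad_mems pL_mem half_shift)

text \<open>Translating every e_i by b moves long roots by 2b, one step of the middle lattice. A
  shear would change nothing: long roots have even b-coordinate, so it shifts them by even multiples
  of a, which are periods.\<close>

lemma state_shift_12:
  assumes "state l R G 1 2 True True True True z x y w"
  shows "state l R G 1 2 True True True True y w z x"
  using assms unfolding state_def
  by (elim iso_transform[where k = 0 and p = "\<lambda>_. 0" and q = "\<lambda>_. 1"])
    (auto simp: quad_period pL_period quad_mems pL_mem half_shift)

text \<open>Short roots move by one step of the full lattice and long roots by one step of the
  middle lattice, so both sets of flags undergo the same permutation.\<close>

lemma state_shift_22:
  assumes "state l R G 2 2 z x y w z' x' y' w'"
  shows "state l R G 2 2 x z w y x' z' w' y'" "state l R G 2 2 y w z x y' w' z' x'"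
proof -
  show "state l R G 2 2 x z w y x' z' w' y'"
    using assms unfolding state_def
    by (elim iso_transform[where k = 0 and p = "\<lambda>_. 1" and q = "\<lambda>_. 0"])
      (auto simp: quad_period pL_period quad_mems pL_mem half_shift)
  show "state l R G 2 2 y w z x y' w' z' x'"
    using assms unfolding state_def
    by (elim iso_transform[where k = 0 and p = "\<lambda>_. 0" and q = "\<lambda>_. 1"])
      (auto simp: quad_period pL_period quad_mems pL_mem half_shift)
qed

section \<open>Orbits of the flags and the named types\<close>

lemmas model_defs = classical_def BCC_def BBv_def CvC_def CvBC_def T1_def T2_def T4_def star_type_def
  BCC_1_star_def BCC_2_star_def CvC_1_star_def CvC_2_star_def CvC_4_star_def CvBC_2_star_def
  CvBC_4_star_def BCC_1_star0'_def CvC_2_star1'_def CvBC_4_star0'_def CvC_2_stars_def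
  CvC_2_starl_def CvC_2_diamond_def Let_def diamond_quad[simplified] Lsij_quad Lij_quad

lemma quad_pL_num:
  "pL 1 1 = quad 1 1 True True True True"
  "quad 1 1 True False True False = pL 2 1" "quad 1 1 True True False False = pL 1 2"
  "quad 1 1 True False False False = pL 2 2"
  "quad 1 2 True True True True = pL 1 2" "quad 1 2 True False True False = pL 2 2"
  "quad 1 2 True True False False = pL 1 4" "quad 1 2 True False False False = pL 2 4"
  "quad 2 1 True True True True = pL 2 1" "quad 2 1 True False True False = pL 4 1"
  "quad 2 1 True True False False = pL 2 2" "quad 2 1 True False False False = pL 4 2"
  "quad 2 2 True True True True = pL 2 2" "quad 2 2 True False True False = pL 4 2"
  "quad 2 2 True True False False = pL 2 4" "quad 2 2 True False False False = pL 4 4"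
  by (simp_all add: quad_pL)

text \<open>Translations act on the long fibre by its periods, so only the shear identifies flags.
  It swaps \<open>y\<close> and \<open>w\<close>, which reduces eight choices to six.\<close>

lemma classify_11:
  assumes "state l R G 1 1 True True True True True x y w"
  shows "iso_to_model l R G (classical BCC T1 l) \<or>
    iso_to_model l R G (BCC_1_star 0 l) \<or>
    iso_to_model l R G (BCC_1_star0' l) \<or>
    iso_to_model l R G (classical BCC (T2 1) l) \<or>
    iso_to_model l R G (classical BBv T1 l) \<or>
    iso_to_model l R G (classical BBv (T2 1) l)"
  using assms state_shear[OF refl _ assms]
  by (cases x; cases y; cases w) (simp_all add: state_def model_defs quad_pL_num)

text \<open>Translation by b identifies the long fibre lacking only \<open>x\<close> with the one
  lacking only \<open>w\<close>, leaving seven types. It also turns the fibre lacking only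
  \<open>y\<close> into one lacking (0,0), the form of \<open>CvC_1_star 1\<close>.\<close>

lemma classify_12:
  assumes "state l R G 1 2 True True True True True x y w"
  shows "iso_to_model l R G (classical CvBC T1 l) \<or>
    iso_to_model l R G (classical CvBC (T2 1) l) \<or>
    iso_to_model l R G (classical CvC T1 l) \<or>
    iso_to_model l R G (CvC_1_star 0 l) \<or>
    iso_to_model l R G (CvC_1_star 1 l) \<or>
    iso_to_model l R G (classical CvC (T2 1) l) \<or>
    iso_to_model l R G (CvC_2_diamond l)"
  using assms state_shift_12[OF assms]
  by (cases x; cases y; cases w) (simp_all add: state_def model_defs quad_pL_num)

text \<open>The shear swaps \<open>y\<close> and \<open>w\<close>; the shift is for the fibre
  lacking only \<open>x\<close>, since \<open>BCC_2_star 1\<close> is written with (0,0) missing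
  instead.\<close>

lemma classify_21:
  assumes "state l R G 2 1 True True True True True x y w"
  shows "iso_to_model l R G (classical BCC (T2 2) l) \<or>
    iso_to_model l R G (BCC_2_star 0 l) \<or>
    iso_to_model l R G (BCC_2_star 1 l) \<or>
    iso_to_model l R G (classical BCC T4 l) \<or>
    iso_to_model l R G (classical BBv (T2 2) l) \<or>
    iso_to_model l R G (classical BBv T4 l)"
  using assms state_shear_21[OF assms] state_shift_21[OF assms]
  by (cases x; cases y; cases w) (simp_all add: state_def model_defs quad_pL_num)

text \<open>A full short fibre is unaffected, so all eight motions act on the long classes. Their
  orbits on nonempty sets are given by the size, except that pairs split according to whether they
  differ in the marked direction.\<close>

lemma orbits_full:
  assumes s: "state l R G 2 2 True True True True True x y w"
    and targets: "state l R G 2 2 True True True True True True False False \<Longrightarrow> P"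
      "state l R G 2 2 True True True True True False False False \<Longrightarrow> P"
      "state l R G 2 2 True True True True True False True False \<Longrightarrow> P"
      "state l R G 2 2 True True True True True True True False \<Longrightarrow> P"
      "state l R G 2 2 True True True True True True True True \<Longrightarrow> P"
  shows P
  using s state_shear[OF refl _ s] state_shift_22(2)[OF s] targets
  by (cases x; cases y; cases w) simp_all

text \<open>The motions fixing the missing short class can only swap the first two long classes, so
  they identify no two of the eight long fibres containing (0,0). Hence eight targets; the second
  and fourth are merely moved into the form in which the list writes them.\<close>

lemma orbits_three:
  assumes s: "state l R G 2 2 True True True False True x y w"
    and targets: "state l R G 2 2 True True True False True False False False \<Longrightarrow> P"
      "state l R G 2 2 False True True True True False True False \<Longrightarrow> P"
      "state l R G 2 2 True True True False True False True False \<Longrightarrow> P"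
      "state l R G 2 2 True True True False False True True True \<Longrightarrow> P"
      "state l R G 2 2 True True True False True True False False \<Longrightarrow> P"
      "state l R G 2 2 True True True False True True False True \<Longrightarrow> P"
      "state l R G 2 2 True True True False True True True False \<Longrightarrow> P"
      "state l R G 2 2 True True True False True True True True \<Longrightarrow> P"
  shows P
proof -
  have t: "state l R G 2 2 True True False True True x w y" using state_shear[OF refl _ s] by simp
  show ?thesis
    using s state_shift_22[OF t] targets by (cases x; cases y; cases w) simp_all
qed

text \<open>By \<open>gen\<close> at most one short class is missing. The holes \<open>w\<close> and
  \<open>y\<close> are exchanged by the shear; the hole \<open>x\<close> reaches \<open>w\<close>
  only by a motion that may take (0,0) out of the long fibre, and this produces the two further
  types \<open>CvBC_2_star 1\<close> and \<open>CvBC_4_star0'\<close>.\<close>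

lemma classify_22:
  assumes s: "state l R G 2 2 True x y w True x' y' w'"
    and gen: "x \<or> y" "y \<or> w" "x \<or> w"
  shows "iso_to_model l R G (classical CvBC (T2 2) l) \<or>
    iso_to_model l R G (CvBC_2_star 0 l) \<or>
    iso_to_model l R G (CvBC_2_star 1 l) \<or>
    iso_to_model l R G (classical CvBC T4 l) \<or>
    iso_to_model l R G (CvBC_4_star 0 l) \<or>
    iso_to_model l R G (CvBC_4_star0' l) \<or>
    iso_to_model l R G (classical CvC (T2 2) l) \<or>
    iso_to_model l R G (CvC_2_stars l) \<or>
    iso_to_model l R G (CvC_2_starl l) \<or>
    iso_to_model l R G (CvC_2_star 0 l) \<or>
    iso_to_model l R G (CvC_2_star 1 l) \<or>
    iso_to_model l R G (CvC_2_star1' l) \<or>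
    iso_to_model l R G (classical CvC T4 l) \<or>
    iso_to_model l R G (CvC_4_star 0 l) \<or>
    iso_to_model l R G (CvC_4_star 1 l)" (is ?thesis)
proof -
  have three: ?thesis if "state l R G 2 2 True True True False True x y w" for x y w
    by (rule orbits_three[OF that]) (simp_all add: state_def model_defs quad_pL_num)
  consider "x" "y" "w" | "x" "y" "\<not> w" | "x" "\<not> y" "w" | "\<not> x" "y" "w" using gen by blast
  then show ?thesis
  proof cases
    case 1
    then have "state l R G 2 2 True True True True True x' y' w'" using s by simp
    then show ?thesis by (rule orbits_full) (simp_all add: state_def model_defs quad_pL_num)
  next
    case 2
    then show ?thesis using three s by simp
  next
    case 3
    then show ?thesis using three state_shear[OF refl _ s] by simp
  next
    case 4
    then have s: "state l R G 2 2 True False True True True x' y' w'" using s by simp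
    show ?thesis
    proof (cases y')
      case True
      \<comment> \<open>Translation by b moves the hole from \<open>x\<close> to \<open>w\<close>,
        and the flag \<open>y'\<close> puts (0,0) back into the long fibre.\<close>
      then show ?thesis using three state_shift_22(2)[OF s] by simp
    next
      case False
      then show ?thesis
        using s state_shift_22[OF s] state_shift_22(2)[OF state_shear[OF refl _ s]]
        by (cases x'; cases w') (simp_all add: state_def model_defs quad_pL_num)
    qed
  qed
qed


lemma (in admissible) classify:
  assumes iso: "iso_to_model l R G (mroots l A B C)"
  shows "iso_to_model l R G (classical BCC T1 l) \<or>
     iso_to_model l R G (BCC_1_star 0 l) \<or>
     iso_to_model l R G (BCC_1_star0' l) \<or>
     iso_to_model l R G (classical BCC (T2 1) l) \<or>
     iso_to_model l R G (classical BCC (T2 2) l) \<or>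
     iso_to_model l R G (BCC_2_star 0 l) \<or>
     iso_to_model l R G (BCC_2_star 1 l) \<or>
     iso_to_model l R G (classical BCC T4 l) \<or>
     iso_to_model l R G (classical CvBC T1 l) \<or>
     iso_to_model l R G (classical CvBC (T2 1) l) \<or>
     iso_to_model l R G (classical CvBC (T2 2) l) \<or>
     iso_to_model l R G (CvBC_2_star 0 l) \<or>
     iso_to_model l R G (CvBC_2_star 1 l) \<or>
     iso_to_model l R G (classical CvBC T4 l) \<or>
     iso_to_model l R G (CvBC_4_star 0 l) \<or>
     iso_to_model l R G (CvBC_4_star0' l) \<or>
     iso_to_model l R G (classical BBv T1 l) \<or>
     iso_to_model l R G (classical BBv (T2 1) l) \<or>
     iso_to_model l R G (classical BBv (T2 2) l) \<or>
     iso_to_model l R G (classical BBv T4 l) \<or>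
     (l = 2 \<and> iso_to_model l R G BBv2_2_star) \<or>
     iso_to_model l R G (classical CvC T1 l) \<or>
     iso_to_model l R G (CvC_1_star 0 l) \<or>
     iso_to_model l R G (CvC_1_star 1 l) \<or>
     iso_to_model l R G (classical CvC (T2 1) l) \<or>
     iso_to_model l R G (classical CvC (T2 2) l) \<or>
     iso_to_model l R G (CvC_2_stars l) \<or>
     iso_to_model l R G (CvC_2_starl l) \<or>
     iso_to_model l R G (CvC_2_star 0 l) \<or>
     iso_to_model l R G (CvC_2_star 1 l) \<or>
     iso_to_model l R G (CvC_2_star1' l) \<or>
     iso_to_model l R G (CvC_2_diamond l) \<or>
     iso_to_model l R G (classical CvC T4 l) \<or>
     iso_to_model l R G (CvC_4_star 0 l) \<or>
     iso_to_model l R G (CvC_4_star 1 l)" (is ?thesis)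
proof -
  have CsubB: "C \<subseteq> B" using B_add_C[of 0 0] zero by auto
  have "pL 1 1 = UNIV" by (auto simp: pL_def)
  then obtain x y w where A: "A = quad 1 1 True x y w"
    using quad_eqI[of A 1 1] A_period zero by auto
  obtain xb yb wb where B: "B = quad 1 1 True xb yb wb"
    using quad_eqI[of B 1 1] \<open>pL 1 1 = UNIV\<close> B_period zero by auto
  have gen: "x \<or> y" "y \<or> w" "x \<or> w" using generating by (auto simp: A quad_mems split: if_splits)
  \<comment> \<open>By \<open>gen\<close> the set \<open>A\<close> has at least three of the four
    classes; a nonzero translation preserving it makes their number even.\<close>
  have full: "x \<and> y \<and> w" if "xb \<or> yb \<or> wb"
    using that gen A_add_B[of 1 0 1 0] A_add_B[of 1 0 0 1] A_add_B[of 1 0 1 1] A_add_B[of 0 1 1 0] A_add_B[of 0 1 0 1] A_add_B[of 0 1 1 1]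
      A_add_B[of 1 1 1 0] A_add_B[of 1 1 0 1] A_add_B[of 1 1 1 1] A_add_B[of 0 0 1 0] A_add_B[of 0 0 0 1] A_add_B[of 0 0 1 1]
    by (cases x; cases y; cases w) (auto simp: A B quad_mems)
  have reduce: "\<exists>x' y' w'. state l R G u v True x y w True x' y' w'" if Buv: "B = pL u v" for u v
  proof -
    have "C = quad u v True ((u, 0) \<in> C) ((0, v) \<in> C) ((u, v) \<in> C)"
      using quad_eqI[of C u v] C_add_B CsubB zero(3) by (simp add: Buv)
    then show ?thesis using iso unfolding state_def A[symmetric] Buv by metis
  qed
  consider "\<not> xb" "\<not> yb" "\<not> wb" | "xb" "\<not> yb" "\<not> wb" | "\<not> xb" "yb" "\<not> wb" | "xb" "yb" "wb"
    | "\<not> xb" "\<not> yb" "wb" | "xb \<or> yb" "yb \<or> wb" "xb \<or> wb" "\<not> (xb \<and> yb \<and> wb)" by blast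
  then show ?thesis
  proof cases
    case 1
    then have "B = pL 2 2" by (simp add: B quad_pL_num)
    then obtain x' y' w' where "state l R G 2 2 True x y w True x' y' w'" using reduce by blast
    from classify_22[OF this gen] show ?thesis by (elim disjE) simp_all
  next
    case 2
    then have "B = pL 1 2" by (simp add: B quad_pL_num)
    then obtain x' y' w' where "state l R G 1 2 True x y w True x' y' w'" using reduce by blast
    then have "state l R G 1 2 True True True True True x' y' w'" using full 2 by simp
    from classify_12[OF this] show ?thesis by (elim disjE) simp_all
  next
    case 3
    then have "B = pL 2 1" by (simp add: B quad_pL_num)
    then obtain x' y' w' where "state l R G 2 1 True x y w True x' y' w'" using reduce by blast
    then have "state l R G 2 1 True True True True True x' y' w'" using full 3 by simp
    from classify_21[OF this] show ?thesis by (elim disjE) simp_all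
  next
    case 4
    then have "B = pL 1 1" by (simp add: B quad_pL_num)
    then obtain x' y' w' where "state l R G 1 1 True x y w True x' y' w'" using reduce by blast
    then have "state l R G 1 1 True True True True True x' y' w'" using full 4 by simp
    from classify_11[OF this] show ?thesis by (elim disjE) simp_all
  next
    case 5
    have Bm: "(m, n) \<in> B \<longleftrightarrow> even (m + n)" for m n using 5 by (auto simp: B quad_mems)
    \<comment> \<open>The middle lattice of pairs with even sum becomes the one with steps 2 and 1
      under the shear of b by a; \<open>C'\<close> is the long fibre after that shear.\<close>
    define C' where "C' = {(m, n). (m - n, n) \<in> C}"
    have C'I: "(m, n) \<in> C' \<longleftrightarrow> (m - n, n) \<in> C" for m n by (simp add: C'_def)
    have per: "(m + 2 * p, n + 2 * q) \<in> C'" if "(m, n) \<in> C'" "(p, q) \<in> pL 2 1" for m n p q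
    proof -
      have "(p - q, q) \<in> B" using that by (simp add: Bm pL_mem)
      from C_add_B[OF _ this, of "m - n" n] that show ?thesis by (simp add: C'I algebra_simps)
    qed
    have sub: "C' \<subseteq> pL 2 1" using CsubB Bm by (auto simp: C'I pL_mem)
    have "(0, 0) \<in> C'" using zero(3) by (simp add: C'I)
    then obtain x' y' w' where C': "C' = quad 2 1 True x' y' w'"
      using quad_eqI[OF sub per] by (metis (full_types))
    have per4: "(m + 4 * r, n + 4 * s) \<in> C' \<longleftrightarrow> (m, n) \<in> C'" for m n r s
      unfolding C' by (rule quad_period)
    have "iso_to_model l R G (mroots l A (pL 2 1) C')"
      by (rule iso_transform[OF iso, where k = 1 and p = "\<lambda>_. 0" and q = "\<lambda>_. 0"])
        (use full 5 per4 in \<open>auto simp: A Bm pL_mem quad_mems C'I pL_period\<close>)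
    then have "state l R G 2 1 True True True True True x' y' w'"
      using full 5 unfolding A C' state_def by simp
    from classify_21[OF this] show ?thesis by (elim disjE) simp_all
  next
    case 6
    have l2: "l = 2"
      using 6 B_add_B[of 1 0 0 1] B_add_B[of 1 0 1 1] B_add_B[of 0 1 1 1] by (auto simp: B quad_mems)
    have Afull: "A = pL 1 1" using full 6 by (auto simp: A quad_pL_num)
    \<comment> \<open>A translation preserving three of the four classes fixes the missing one, so
      it is trivial modulo 2.\<close>
    have ev: "even p \<and> even q" if "(p, q) \<in> C" for p q
      using 6 B_add_C[OF _ that, of 0 0] B_add_C[OF _ that, of 1 0] B_add_C[OF _ that, of 0 1]
        B_add_C[OF _ that, of 1 1]
      by (cases xb; cases yb; cases wb; cases "even p"; cases "even q") (simp_all add: B quad_mems)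
    \<comment> \<open>Every pair lies in \<open>B\<close> or is a sum of two elements of
      \<open>B\<close>, and \<open>C\<close> contains 0 and absorbs 2B.\<close>
    have dbl: "(2 * m, 2 * n) \<in> C" for m n
    proof (cases "(m, n) \<in> B")
      case True
      then show ?thesis using C_add_B[OF zero(3)] by fastforce
    next
      case False
      have "(1, 0) \<in> B \<and> (m - 1, n) \<in> B \<or> (0, 1) \<in> B \<and> (m, n - 1) \<in> B"
        using False 6 by (auto simp: B quad_mems split: if_splits)
      then show ?thesis
        using C_add_B[of 2 0 "m - 1" n] C_add_B[of 0 2 m "n - 1"] C_add_B[OF zero(3), of 1 0] C_add_B[OF zero(3), of 0 1]
        by auto
    qed
    have C: "C = pL 2 2"
    proof (intro equalityI subsetI)
      fix z assume "z \<in> C"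
      then show "z \<in> pL 2 2" using ev by (cases z) (auto simp: pL_mem)
    qed (use dbl in \<open>auto simp: pL_def\<close>)
    have "iso_to_model 2 R G (mroots 2 (pL 1 1) (quad 1 1 True True True False) (pL 2 2))"
    proof -
      consider "xb" "yb" "\<not> wb" | "xb" "\<not> yb" "wb" | "\<not> xb" "yb" "wb" using 6 by blast
      then show ?thesis
      proof cases
        case 1
        then show ?thesis using iso by (simp add: l2 Afull B C)
      next
        case 2
        then show ?thesis using iso unfolding l2 Afull B C
          by (elim iso_transform[where k = 1 and p = "\<lambda>_. 0" and q = "\<lambda>_. 0"])
            (auto simp: pL_mem quad_mems)
      next
        case 3
        \<comment> \<open>Only one of the two frame vectors moves by b: this shifts the middle fibre
          by b, whereas moving both would shift it by the period 2b. The long fibre is stable under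
          2b.\<close>
        then show ?thesis using iso unfolding l2 Afull B C
          by (elim iso_transform[where k = 0 and p = "\<lambda>_. 0" and q = "\<lambda>i. if i = 1 then 1 else 0"])
            (auto simp: pL_mem quad_mems)
      qed
    qed
    then have "iso_to_model l R G BBv2_2_star" by (simp add: l2 BBv2_2_star_def Lij_quad)
    then show ?thesis using l2 by blast
  qed
qed

section \<open>Rank one and the final list\<close>

lemma middle_irrelevant: "mroots 1 A B C = mroots 1 A B' C"
proof -
  have "BCm 1 = {}" by (auto simp: BCm_def)
  then show ?thesis by (simp add: mroots_def)
qed

text \<open>In rank one these pairs of types differ at most in their middle parts, which are empty,
  so the names reserved for higher rank fold into others on the list.\<close>

lemma classical_rank_one:
  "classical BCC (T2 1) 1 = classical BCC (T2 2) 1"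
  "classical CvBC (T2 1) 1 = classical CvBC (T2 2) 1"
  "classical CvC (T2 1) 1 = classical CvC (T2 2) 1"
  "classical BBv T1 1 = classical CvC T1 1"
  "classical BBv (T2 1) 1 = classical CvC (T2 2) 1"
  "classical BBv (T2 2) 1 = classical CvC (T2 2) 1"
  "classical BBv T4 1 = classical CvC T4 1"
  unfolding classical_def BCC_def BBv_def CvC_def CvBC_def T1_def T2_def T4_def
  by (simp_all only: prod.case, (rule middle_irrelevant)+)

theorem mainTheorem2:
  fixes l :: nat and I :: "'a::euclidean_space \<Rightarrow> 'a \<Rightarrow> real" and R G :: "'a set"
  assumes "l \<ge> 1"
    and "DIM('a) = l + 2"
    and "marked_elliptic_root_system l I R G"
    and "\<not> reduced R"
  shows
    "\<comment> \<open>(1) R/G of type BCC_l\<close>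
     iso_to_model l R G (classical BCC T1 l) \<or>
     iso_to_model l R G (BCC_1_star 0 l) \<or>
     iso_to_model l R G (BCC_1_star0' l) \<or>
     (l > 1 \<and> iso_to_model l R G (classical BCC (T2 1) l)) \<or>
     iso_to_model l R G (classical BCC (T2 2) l) \<or>
     iso_to_model l R G (BCC_2_star 0 l) \<or>
     iso_to_model l R G (BCC_2_star 1 l) \<or>
     iso_to_model l R G (classical BCC T4 l) \<or>
     \<comment> \<open>(2) R/G of type C^\<or>BC_l\<close>
     iso_to_model l R G (classical CvBC T1 l) \<or>
     (l > 1 \<and> iso_to_model l R G (classical CvBC (T2 1) l)) \<or>
     iso_to_model l R G (classical CvBC (T2 2) l) \<or>
     iso_to_model l R G (CvBC_2_star 0 l) \<or>
     iso_to_model l R G (CvBC_2_star 1 l) \<or>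
     iso_to_model l R G (classical CvBC T4 l) \<or>
     iso_to_model l R G (CvBC_4_star 0 l) \<or>
     iso_to_model l R G (CvBC_4_star0' l) \<or>
     \<comment> \<open>(3) R/G of type BB_l^\<or>, l \<ge> 2\<close>
     (l \<ge> 2 \<and> iso_to_model l R G (classical BBv T1 l)) \<or>
     (l \<ge> 2 \<and> iso_to_model l R G (classical BBv (T2 1) l)) \<or>
     (l \<ge> 2 \<and> iso_to_model l R G (classical BBv (T2 2) l)) \<or>
     (l \<ge> 2 \<and> iso_to_model l R G (classical BBv T4 l)) \<or>
     (l = 2 \<and> iso_to_model l R G BBv2_2_star) \<or>
     \<comment> \<open>(4) R/G of type C^\<or>C_l\<close>
     iso_to_model l R G (classical CvC T1 l) \<or>
     iso_to_model l R G (CvC_1_star 0 l) \<or>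
     iso_to_model l R G (CvC_1_star 1 l) \<or>
     (l > 1 \<and> iso_to_model l R G (classical CvC (T2 1) l)) \<or>
     iso_to_model l R G (classical CvC (T2 2) l) \<or>
     iso_to_model l R G (CvC_2_stars l) \<or>
     iso_to_model l R G (CvC_2_starl l) \<or>
     iso_to_model l R G (CvC_2_star 0 l) \<or>
     iso_to_model l R G (CvC_2_star 1 l) \<or>
     iso_to_model l R G (CvC_2_star1' l) \<or>
     iso_to_model l R G (CvC_2_diamond l) \<or>
     iso_to_model l R G (classical CvC T4 l) \<or>
     iso_to_model l R G (CvC_4_star 0 l) \<or>
     iso_to_model l R G (CvC_4_star 1 l)"
proof -
  obtain A B C where "admissible l A B C" "iso_to_model l R G (mroots l A B C)"
    using elliptic_coordinates[OF assms(2-4)] by blast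
  note cls = admissible.classify[OF this]
  show ?thesis
  proof (cases "l = 1")
    case True
    show ?thesis using cls unfolding True classical_rank_one by (elim disjE) simp_all
  next
    case False
    then have "l > 1" "l \<ge> 2" using assms(1) by auto
    then show ?thesis using cls by simp
  qed
qed

end
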